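(* Let $p$ be a constant, independent of $n$, satisfying $1-\frac{1}{\sqrt{2}}<p<1$, and let $\Gamma\in G(n,p)$ be a random graph. Then the right-angled Artin group $A_\Gamma$ determined by $\Gamma$ has a finite outer automorphism group $\mathrm{Out}(A_\Gamma)$, asymptotically almost surely.
   Context: Right-angled Artin group: for a finite simplicial graph $\Gamma$ with vertex set $V$, $A_\Gamma=\langle V\mid vw=wv \text{ if } v \text{ and } w \text{ are connected by an edge in } \Gamma\rangle$. $\mathrm{Out}(A_\Gamma)$ is the quotient of $\mathrm{Aut}(A_\Gamma)$ by the inner automorphisms. Random graph model (Erdős–Rényi): $G(n,p)$ is the probability space of all graphs on the vertex set $\{1,\dots,n\}$, each edge of the complete graph being included independently with probability $p$; thus $\mathrm{Prob}(\Gamma)=p^{E_\Gamma}(1-p)^{\binom n2-E_\Gamma}$, where $E_\Gamma$ is the number of edges of $\Gamma$. A statement about $\Gamma\in G(n,p)$ holds asymptotically almost surely if the probability that it holds tends to $1$ as $n\to\infty$. *)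

theory Defs
  imports
    "HOL-Algebra.Bij"
    "HOL-Algebra.Coset"
    "HOL-Algebra.Group_Action"
    "HOL-Probability.Product_PMF"
begin

section \<open>Groups given by generators and relations\<close>

text \<open>
  A letter \<open>(s, True)\<close> stands for the generator \<open>s\<close>, and \<open>(s, False)\<close> for its formal
  inverse. A relation \<open>r = r'\<close> is a pair of words; relations mentioning letters outside
  the generating set \<open>S\<close> are ignored.
\<close>

type_synonym 'a word = "('a \<times> bool) list"

definition words :: "'a set \<Rightarrow> 'a word set" where
  "words S = lists (S \<times> UNIV)"

inductive_set word_cong :: "'a set \<Rightarrow> ('a word \<times> 'a word) set \<Rightarrow> ('a word \<times> 'a word) set"
  for S :: "'a set" and R :: "('a word \<times> 'a word) set"
where
  refl: "u \<in> words S \<Longrightarrow> (u, u) \<in> word_cong S R"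
| sym: "(u, v) \<in> word_cong S R \<Longrightarrow> (v, u) \<in> word_cong S R"
| trans: "(u, v) \<in> word_cong S R \<Longrightarrow> (v, w) \<in> word_cong S R \<Longrightarrow> (u, w) \<in> word_cong S R"
| cancel: "u \<in> words S \<Longrightarrow> v \<in> words S \<Longrightarrow> s \<in> S \<Longrightarrow>
    (u @ [(s, b), (s, \<not> b)] @ v, u @ v) \<in> word_cong S R"
| relation: "u \<in> words S \<Longrightarrow> v \<in> words S \<Longrightarrow> r \<in> words S \<Longrightarrow> r' \<in> words S \<Longrightarrow> (r, r') \<in> R \<Longrightarrow>
    (u @ r @ v, u @ r' @ v) \<in> word_cong S R"

definition presented_group :: "'a set \<Rightarrow> ('a word \<times> 'a word) set \<Rightarrow> 'a word set monoid" where
  "presented_group S R =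
    \<lparr>carrier = words S // word_cong S R,
     monoid.mult = (\<lambda>X Y. \<Union>x\<in>X. \<Union>y\<in>Y. word_cong S R `` {x @ y}),
     one = word_cong S R `` {[]}\<rparr>"

lemma words_append_iff [simp]: "u @ v \<in> words S \<longleftrightarrow> u \<in> words S \<and> v \<in> words S"
  by (auto simp: words_def)

lemma words_Nil [simp]: "[] \<in> words S"
  by (simp add: words_def)

lemma words_Cons [simp]: "a # u \<in> words S \<longleftrightarrow> fst a \<in> S \<and> u \<in> words S"
  by (cases a) (auto simp: words_def)

lemma word_cong_in_words: "(u, v) \<in> word_cong S R \<Longrightarrow> u \<in> words S \<and> v \<in> words S"
  by (induction rule: word_cong.induct) auto

lemma equiv_word_cong: "equiv (words S) (word_cong S R)"
  by (rule equivI)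
    (auto simp: refl_on_def sym_def trans_def
          intro: word_cong.refl word_cong.sym word_cong.trans dest: word_cong_in_words)

lemma word_cong_append_context:
  assumes "(u, v) \<in> word_cong S R" "x \<in> words S" "y \<in> words S"
  shows "(x @ u @ y, x @ v @ y) \<in> word_cong S R"
  using assms(1)
proof (induction rule: word_cong.induct)
  case (cancel u v s b)
  then show ?case
    using word_cong.cancel[of "x @ u" S "v @ y" s b R] assms by simp
next
  case (relation u v r r')
  then show ?case
    using word_cong.relation[of "x @ u" S "v @ y" r r' R] assms by simp
qed (use assms in \<open>auto intro: word_cong.refl word_cong.sym word_cong.trans\<close>)

lemma word_cong_append:
  assumes "(u, u') \<in> word_cong S R" "(v, v') \<in> word_cong S R"
  shows "(u @ v, u' @ v') \<in> word_cong S R"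
proof (rule word_cong.trans)
  show "(u @ v, u' @ v) \<in> word_cong S R"
    using word_cong_append_context[OF assms(1), of "[]" v] assms
    by (auto dest: word_cong_in_words)
  show "(u' @ v, u' @ v') \<in> word_cong S R"
    using word_cong_append_context[OF assms(2), of u' "[]"] assms
    by (auto dest: word_cong_in_words)
qed

lemma presented_group_mult:
  assumes "u \<in> words S" "v \<in> words S"
  shows "word_cong S R `` {u} \<otimes>\<^bsub>presented_group S R\<^esub> word_cong S R `` {v} = word_cong S R `` {u @ v}"
proof -
  have "congruent2 (word_cong S R) (word_cong S R) (\<lambda>x y. word_cong S R `` {x @ y})"
    by (intro congruent2I' equiv_class_eq[OF equiv_word_cong] word_cong_append)
  from UN_equiv_class2[OF equiv_word_cong equiv_word_cong this assms]
  show ?thesis by (simp add: presented_group_def)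
qed

definition word_inverse :: "'a word \<Rightarrow> 'a word" where
  "word_inverse u = rev (map (\<lambda>(s, b). (s, \<not> b)) u)"

lemma word_inverse_in_words [simp]: "word_inverse u \<in> words S \<longleftrightarrow> u \<in> words S"
  by (induction u) (auto simp: word_inverse_def)

lemma word_inverse_left: "u \<in> words S \<Longrightarrow> (word_inverse u @ u, []) \<in> word_cong S R"
proof (induction u)
  case Nil
  then show ?case by (auto simp: word_inverse_def intro: word_cong.refl)
next
  case (Cons a u)
  obtain s b where a: "a = (s, b)" by (cases a)
  have "(word_inverse u @ [(s, \<not> b), (s, \<not> \<not> b)] @ u, word_inverse u @ u) \<in> word_cong S R"
    using Cons.prems by (intro word_cong.cancel) (auto simp: a)
  then show ?case
    using Cons word_cong.trans by (fastforce simp: a word_inverse_def)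
qed

lemma group_presented_group: "group (presented_group S R)"
proof -
  let ?G = "presented_group S R" and ?c = "\<lambda>u. word_cong S R `` {u}"
  have carrier: "carrier ?G = ?c ` words S"
    by (auto simp: presented_group_def quotient_def)
  have one: "\<one>\<^bsub>?G\<^esub> = ?c []"
    by (simp add: presented_group_def)
  show ?thesis
  proof (rule groupI)
    fix x assume "x \<in> carrier ?G"
    then obtain u where u: "x = ?c u" "u \<in> words S" by (auto simp: carrier)
    have "?c (word_inverse u) \<otimes>\<^bsub>?G\<^esub> x = \<one>\<^bsub>?G\<^esub>"
      using u by (simp add: presented_group_mult one
          equiv_class_eq[OF equiv_word_cong word_inverse_left])
    then show "\<exists>y\<in>carrier ?G. y \<otimes>\<^bsub>?G\<^esub> x = \<one>\<^bsub>?G\<^esub>"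
      using u by (auto simp: carrier)
  qed (auto simp: carrier one presented_group_mult)
qed


section \<open>Right-angled Artin groups\<close>

text \<open>A graph is given by its vertex set and its set of edges, an edge being a two-element set.\<close>

definition raag :: "'a set \<Rightarrow> 'a set set \<Rightarrow> 'a word set monoid" where
  "raag V E = presented_group V
    {([(v, True), (w, True)], [(w, True), (v, True)]) | v w. {v, w} \<in> E}"

lemma group_raag: "group (raag V E)"
  by (simp add: raag_def group_presented_group)


section \<open>Outer automorphism groups\<close>

definition inner_auto :: "('a, 'b) monoid_scheme \<Rightarrow> ('a \<Rightarrow> 'a) set" where
  "inner_auto G = (\<lambda>g. \<lambda>x\<in>carrier G. g \<otimes>\<^bsub>G\<^esub> x \<otimes>\<^bsub>G\<^esub> inv\<^bsub>G\<^esub> g) ` carrier G"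

definition Out :: "('a, 'b) monoid_scheme \<Rightarrow> ('a \<Rightarrow> 'a) set monoid" where
  "Out G = AutoGroup G Mod inner_auto G"

lemma (in group) conj_in_auto:
  assumes "g \<in> carrier G"
  shows "(\<lambda>x\<in>carrier G. g \<otimes> x \<otimes> inv g) \<in> auto G"
proof -
  have "(\<lambda>x\<in>carrier G. g \<otimes> x \<otimes> inv g) \<in> Bij (carrier G)"
    using assms conjugation_is_bij[OF assms] by (simp add: Bij_def)
  moreover have "(\<lambda>x\<in>carrier G. g \<otimes> x \<otimes> inv g) \<in> hom G G"
  proof (rule homI)
    fix x y assume "x \<in> carrier G" "y \<in> carrier G"
    then show "(\<lambda>x\<in>carrier G. g \<otimes> x \<otimes> inv g) (x \<otimes> y) =
        (\<lambda>x\<in>carrier G. g \<otimes> x \<otimes> inv g) x \<otimes> (\<lambda>x\<in>carrier G. g \<otimes> x \<otimes> inv g) y"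
      using assms by (simp add: m_assoc inv_solve_left)
  qed (use assms in auto)
  ultimately show ?thesis by (simp add: auto_def)
qed

lemma (in group) normal_inner_auto: "inner_auto G \<lhd> AutoGroup G"
proof -
  let ?A = "AutoGroup G" and ?c = "\<lambda>g. \<lambda>x\<in>carrier G. g \<otimes> x \<otimes> inv g"
  interpret A: group ?A by (rule AutoGroup)
  have carrier: "carrier ?A = auto G"
    by (simp add: AutoGroup_def)
  have mult: "a \<otimes>\<^bsub>?A\<^esub> b = compose (carrier G) a b" if "a \<in> auto G" "b \<in> auto G" for a b
    using that by (auto simp: AutoGroup_def BijGroup_def auto_def)
  have hom: "?c \<in> hom G ?A"
  proof (rule homI)
    fix g h assume gh: "g \<in> carrier G" "h \<in> carrier G"
    show "?c (g \<otimes> h) = ?c g \<otimes>\<^bsub>?A\<^esub> ?c h"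
      using gh by (subst mult) (auto simp: conj_in_auto compose_def inv_mult_group m_assoc
          intro!: restrict_ext)
  qed (simp add: carrier conj_in_auto)
  then interpret c: group_hom G ?A ?c
    by (simp add: group_hom_def group_hom_axioms_def A.group_axioms group_axioms)
  have "subgroup (inner_auto G) ?A"
    unfolding inner_auto_def by (rule c.img_is_subgroup)
  moreover have "a \<otimes>\<^bsub>?A\<^esub> b \<otimes>\<^bsub>?A\<^esub> inv\<^bsub>?A\<^esub> a \<in> inner_auto G"
    if a: "a \<in> carrier ?A" and b: "b \<in> inner_auto G" for a b
  proof -
    obtain g where g: "g \<in> carrier G" and b_eq: "b = ?c g"
      using b by (auto simp: inner_auto_def)
    have a': "a \<in> auto G" and ag: "a g \<in> carrier G"
      using a g by (auto simp: carrier auto_def hom_def)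
    interpret a: group_hom G G a
      using a' by unfold_locales (simp add: auto_def)
    have "a \<otimes>\<^bsub>?A\<^esub> ?c g = ?c (a g) \<otimes>\<^bsub>?A\<^esub> a"
      using g ag a' by (simp add: mult conj_in_auto)
        (auto simp: compose_def intro!: restrict_ext)
    moreover have "?c (a g) \<in> carrier ?A"
      unfolding carrier by (rule conj_in_auto[OF ag])
    ultimately have "a \<otimes>\<^bsub>?A\<^esub> b \<otimes>\<^bsub>?A\<^esub> inv\<^bsub>?A\<^esub> a = ?c (a g)"
      unfolding b_eq using a by (simp del: c.hom_closed add: A.m_assoc)
    then show ?thesis
      using ag by (auto simp: inner_auto_def)
  qed
  ultimately show ?thesis
    by (simp add: A.normal_inv_iff)
qed


section \<open>The Erdos-Renyi random graph\<close>

definition complete_edges :: "'a set \<Rightarrow> 'a set set" where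
  "complete_edges V = {e. e \<subseteq> V \<and> card e = 2}"

text \<open>The random edge set of \<open>G(n,p)\<close>; the vertex set is always \<open>{1..n}\<close>.\<close>

definition random_graph :: "nat \<Rightarrow> real \<Rightarrow> nat set set pmf" where
  "random_graph n p =
    map_pmf (\<lambda>f. {e \<in> complete_edges {1..n}. f e})
      (Pi_pmf (complete_edges {1..n}) False (\<lambda>_. bernoulli_pmf p))"

lemma pmf_random_graph:
  assumes "E \<subseteq> complete_edges {1..n}" "0 \<le> p" "p \<le> 1"
  shows "pmf (random_graph n p) E = p ^ card E * (1 - p) ^ ((n choose 2) - card E)"
proof -
  let ?K = "complete_edges {1..n}"
  have fin: "finite ?K"
    by (rule finite_subset[of _ "Pow {1..n}"]) (auto simp: complete_edges_def)
  have card_K: "card ?K = n choose 2"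
    using n_subsets[of "{1..n}" 2] by (simp add: complete_edges_def)
  have eq: "(\<lambda>f. {e \<in> ?K. f e}) -` {E} = Pi ?K (\<lambda>e. {e \<in> E})"
    using assms(1) by (auto simp: Pi_def)
  have "pmf (random_graph n p) E =
      (\<Prod>e\<in>?K. measure_pmf.prob (bernoulli_pmf p) {e \<in> E})"
    by (simp only: random_graph_def pmf_map eq measure_Pi_pmf_Pi[OF fin])
  also have "\<dots> = (\<Prod>e\<in>?K. if e \<in> E then p else 1 - p)"
    using assms by (intro prod.cong) (auto simp: measure_pmf_single)
  also have "\<dots> = (\<Prod>e\<in>E. p) * (\<Prod>e\<in>?K - E. 1 - p)"
    using assms(1) fin by (simp add: prod.If_cases Int_absorb1 Diff_eq)
  also have "\<dots> = p ^ card E * (1 - p) ^ ((n choose 2) - card E)"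
    using assms(1) fin by (simp add: card_Diff_subset finite_subset flip: card_K)
  finally show ?thesis .
qed

end

(*
For a graph in which any two vertices a, b have a common neighbour outside the star of any
prescribed third vertex x, Out of the right-angled Artin group A is finite; by a union bound the
random graph has this property asymptotically almost surely for every constant 0 < p < 1.

Maps to the Heisenberg group show that commuting elements have exponent vectors that are
proportional on each pair of non-adjacent vertices. This forces the matrix of an automorphism on
the abelianisation to have entries in {-1, 0, 1}, so only finitely many matrices occur, and it
remains to show that an automorphism phi acting trivially on the abelianisation is inner. For each
vertex x let A act on the Bass-Serre tree of the HNN splitting of A with stable letter x, whose
vertex stabilisers are the conjugates of the subgroup generated by the other vertices and whose
edge stabilisers are the conjugates of the subgroup generated by the link of x. If u, v are
adjacent and outside the star of x, then the commuting elements phi(u), phi(v) act freely on edges,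
as a free abelian group of rank 2; this is impossible unless phi(u) fixes a vertex, which is then
unique. By the extension property all phi(v) with v not x fix the same vertex h_x. The cosets h_x
for the various x have a common element h by a Helly argument using the retractions of A, and
conjugating by h gives phi(v) = h v h^-1 for all v.
*)
theory Submission
  imports Defs "HOL-Real_Asymp.Real_Asymp"
begin

section \<open>Right-angled Artin groups\<close>

lemma (in group) inv_conj_mult:
  assumes "a \<in> carrier G" "h \<in> carrier G" "k \<in> carrier G"
  shows "inv (h \<otimes> k) \<otimes> a \<otimes> (h \<otimes> k) = inv k \<otimes> (inv h \<otimes> a \<otimes> h) \<otimes> k"
  using assms by (simp add: inv_mult_group m_assoc)

lemma (in group) commute_conj:
  assumes "a \<otimes> k = k \<otimes> a" "a \<in> carrier G" "k \<in> carrier G"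
  shows "inv k \<otimes> a \<otimes> k = a"
  using assms by (simp add: m_assoc) (simp flip: m_assoc)

lemma (in group) conj_commute:
  assumes "a \<otimes> b = b \<otimes> a" "a \<in> carrier G" "b \<in> carrier G" "h \<in> carrier G"
  shows "(inv h \<otimes> a \<otimes> h) \<otimes> (inv h \<otimes> b \<otimes> h) = (inv h \<otimes> b \<otimes> h) \<otimes> (inv h \<otimes> a \<otimes> h)"
proof -
  have *: "h \<otimes> (inv h \<otimes> z) = z" if "z \<in> carrier G" for z
    using that assms by (simp flip: m_assoc)
  have "a \<otimes> (b \<otimes> h) = b \<otimes> (a \<otimes> h)"
    using assms by (simp flip: m_assoc)
  then show ?thesis using assms by (simp add: m_assoc *)
qed

text \<open>Letters operating on a set induce an operation of the presented group as soon as inverse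
  letters cancel and both sides of each relation operate alike. Every invariant below is built on
  this principle.\<close>

lemma foldr_word_cong:
  assumes "(u, v) \<in> word_cong S R" "z \<in> Z"
    and closed: "\<And>s b z. s \<in> S \<Longrightarrow> z \<in> Z \<Longrightarrow> f (s, b) z \<in> Z"
    and cancel: "\<And>s b z. s \<in> S \<Longrightarrow> z \<in> Z \<Longrightarrow> f (s, b) (f (s, \<not> b) z) = z"
    and rel: "\<And>r r' z. (r, r') \<in> R \<Longrightarrow> r \<in> words S \<Longrightarrow> r' \<in> words S \<Longrightarrow> z \<in> Z \<Longrightarrow>
      foldr f r z = foldr f r' z"
  shows "foldr f u z = foldr f v z"
proof -
  have *: "foldr f w z \<in> Z" if "w \<in> words S" "z \<in> Z" for w z
    using that by (induction w) (auto intro: closed)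
  show ?thesis
    using assms(1,2) by (induction) (use * in \<open>auto simp: cancel rel\<close>)
qed

section \<open>Elements, generators and standard subgroups\<close>

locale raag_graph =
  fixes V :: "'a set" and E :: "'a set set" and G (structure)
  assumes finite_V: "finite V" and G_def: "G = raag V E"
begin

sublocale group G
  by (simp add: G_def group_raag)

abbreviation rels :: "('a word \<times> 'a word) set" where
  "rels \<equiv> {([(v, True), (w, True)], [(w, True), (v, True)]) | v w. {v, w} \<in> E}"

definition cls :: "'a word \<Rightarrow> 'a word set" where
  "cls w = word_cong V rels `` {w}"

definition gen :: "'a \<Rightarrow> bool \<Rightarrow> 'a word set" where
  "gen s b = cls [(s, b)]"

text \<open>The standard subgroup generated by \<open>X\<close>, realised inside the whole group, so
  that subgroups for different \<open>X\<close> can be intersected and compared.\<close>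

definition sub :: "'a set \<Rightarrow> 'a word set set" where
  "sub X = cls ` words X"

definition link :: "'a \<Rightarrow> 'a set" where
  "link x = {v \<in> V - {x}. {v, x} \<in> E}"

lemma words_mono: "X \<subseteq> Y \<Longrightarrow> words X \<subseteq> words Y"
  by (auto simp: words_def)

lemma carrier_eq: "carrier G = cls ` words V"
  by (auto simp: G_def raag_def presented_group_def quotient_def cls_def)

lemma cls_closed: "w \<in> words V \<Longrightarrow> cls w \<in> carrier G"
  by (simp add: carrier_eq)

lemma sub_V: "sub V = carrier G"
  by (simp add: sub_def carrier_eq)

lemma sub_mono: "X \<subseteq> Y \<Longrightarrow> sub X \<subseteq> sub Y"
  unfolding sub_def by (intro image_mono words_mono)

lemma sub_carrier: "X \<subseteq> V \<Longrightarrow> g \<in> sub X \<Longrightarrow> g \<in> carrier G"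
  using sub_mono sub_V by blast

lemma one_eq: "\<one> = cls []"
  by (simp add: G_def raag_def presented_group_def cls_def)

lemma mult_cls: "u \<in> words V \<Longrightarrow> v \<in> words V \<Longrightarrow> cls u \<otimes> cls v = cls (u @ v)"
  using presented_group_mult[of u V v rels] by (simp add: G_def raag_def cls_def)

lemma cls_eq_iff: "u \<in> words V \<Longrightarrow> v \<in> words V \<Longrightarrow> cls u = cls v \<longleftrightarrow> (u, v) \<in> word_cong V rels"
  unfolding cls_def using eq_equiv_class_iff[OF equiv_word_cong] by blast

lemma one_sub: "\<one> \<in> sub X"
  by (simp add: one_eq sub_def)

lemma gen_closed [simp]: "s \<in> V \<Longrightarrow> gen s b \<in> carrier G"
  by (simp add: gen_def cls_closed)

lemma gen_sub: "s \<in> X \<Longrightarrow> gen s b \<in> sub X"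
  by (simp add: gen_def sub_def)

lemma cls_Cons: "s \<in> V \<Longrightarrow> w \<in> words V \<Longrightarrow> cls ((s, b) # w) = gen s b \<otimes> cls w"
  by (simp add: gen_def mult_cls)

lemma gen_cancel: "s \<in> V \<Longrightarrow> gen s b \<otimes> gen s (\<not> b) = \<one>"
  using word_cong.cancel[of "[]" V "[]" s b rels]
  by (simp add: gen_def mult_cls one_eq cls_eq_iff)

lemma inv_gen: "s \<in> V \<Longrightarrow> inv (gen s b) = gen s (\<not> b)"
  using gen_cancel[of s "\<not> b"] by (intro inv_equality) auto

lemma sub_induct [consumes 2, case_names one step]:
  assumes "g \<in> sub X" "X \<subseteq> V" "P \<one>"
    and "\<And>s b g. s \<in> X \<Longrightarrow> s \<in> V \<Longrightarrow> g \<in> sub X \<Longrightarrow> g \<in> carrier G \<Longrightarrow> P g \<Longrightarrow> P (gen s b \<otimes> g)"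
  shows "P g"
proof -
  have "P (cls w)" if "w \<in> words X" for w
    using that
  proof (induction w)
    case Nil
    then show ?case using assms by (simp add: one_eq)
  next
    case (Cons a w)
    obtain s b where a: "a = (s, b)" by (cases a)
    have s: "s \<in> X" "w \<in> words X" using Cons a by auto
    then have "w \<in> words V" using words_mono assms(2) by blast
    with s show ?case
      using assms Cons.IH unfolding a
      by (subst cls_Cons) (auto simp: sub_def cls_closed)
  qed
  with assms(1) show ?thesis by (auto simp: sub_def)
qed

lemma carrier_induct [consumes 1, case_names one step]:
  assumes "g \<in> carrier G" "P \<one>"
    and "\<And>s b g. s \<in> V \<Longrightarrow> g \<in> carrier G \<Longrightarrow> P g \<Longrightarrow> P (gen s b \<otimes> g)"
  shows "P g"
  using sub_induct[of g V P] assms by (simp add: sub_V)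

lemma subgroup_sub:
  assumes "X \<subseteq> V"
  shows "subgroup (sub X) G"
proof (rule subgroupI)
  have wX: "w \<in> words V" if "w \<in> words X" for w
    using that words_mono[OF assms] by blast
  show "sub X \<subseteq> carrier G" using sub_carrier[OF assms] by blast
  show "sub X \<noteq> {}" using one_sub by blast
  show mult: "a \<otimes> b \<in> sub X" if "a \<in> sub X" "b \<in> sub X" for a b
    using that wX by (auto simp: sub_def mult_cls)
  show "inv a \<in> sub X" if "a \<in> sub X" for a
    using that assms
  proof (induction rule: sub_induct)
    case one
    then show ?case by (simp add: one_sub)
  next
    case (step s b g)
    moreover have "gen s (\<not> b) \<in> sub X" using step by (intro gen_sub)
    ultimately show ?case
      using mult assms by (simp add: inv_mult_group inv_gen subset_iff)
  qed
qed

lemma gen_commute: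
  assumes "{v, w} \<in> E" "v \<in> V" "w \<in> V"
  shows "gen v b \<otimes> gen w b' = gen w b' \<otimes> gen v b"
proof -
  have 1: "gen v True \<otimes> gen w True = gen w True \<otimes> gen v True"
    using word_cong.relation[of "[]" V "[]" "[(v, True), (w, True)]" "[(w, True), (v, True)]" rels] assms
    by (auto simp: gen_def mult_cls cls_eq_iff)
  have *: "inv a \<otimes> c = c \<otimes> inv a" if "a \<otimes> c = c \<otimes> a" "a \<in> carrier G" "c \<in> carrier G" for a c
    using that by (metis inv_closed inv_solve_left inv_solve_right m_assoc m_closed)
  have 2: "gen v b \<otimes> gen w True = gen w True \<otimes> gen v b"
    using 1 *[OF 1] assms by (cases b) (auto simp: inv_gen)
  show ?thesis
    using 2 *[OF 2[symmetric]] assms by (cases b') (auto simp: inv_gen)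
qed

section \<open>Actions prescribed on the generators\<close>

definition action :: "('a \<times> bool \<Rightarrow> 'z \<Rightarrow> 'z) \<Rightarrow> 'z set \<Rightarrow> bool" where
  "action f Z \<longleftrightarrow> (\<forall>s\<in>V. \<forall>b. \<forall>z\<in>Z. f (s, b) z \<in> Z \<and> f (s, b) (f (s, \<not> b) z) = z) \<and>
    (\<forall>s\<in>V. \<forall>t\<in>V. {s, t} \<in> E \<longrightarrow> (\<forall>z\<in>Z. f (s, True) (f (t, True) z) = f (t, True) (f (s, True) z)))"

text \<open>The choice of a word is immaterial by \<open>act_cls\<close>. The domain
  \<open>Z\<close> of an action is explicit because on the tree the letters cancel only on reduced
  words.\<close>

definition act :: "('a \<times> bool \<Rightarrow> 'z \<Rightarrow> 'z) \<Rightarrow> 'a word set \<Rightarrow> 'z \<Rightarrow> 'z" where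
  "act f g z = foldr f (SOME w. w \<in> words V \<and> g = cls w) z"

lemma act_cls:
  assumes "action f Z" "z \<in> Z" "w \<in> words V"
  shows "act f (cls w) z = foldr f w z"
proof -
  define w' where "w' = (SOME w'. w' \<in> words V \<and> cls w = cls w')"
  have "w' \<in> words V \<and> cls w = cls w'"
    unfolding w'_def by (rule someI[of _ w]) (use assms in auto)
  then have "(w', w) \<in> word_cong V rels"
    using assms cls_eq_iff by auto
  then have "foldr f w' z = foldr f w z"
  proof (rule foldr_word_cong[where Z = Z])
    show "foldr f r z = foldr f r' z"
      if "(r, r') \<in> rels" "r \<in> words V" "r' \<in> words V" "z \<in> Z" for r r' z
    proof -
      from that(1) obtain s t
        where "r = [(s, True), (t, True)]" "r' = [(t, True), (s, True)]" "{s, t} \<in> E"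
        by blast
      moreover from this have "f (s, True) (f (t, True) z) = f (t, True) (f (s, True) z)"
        using that assms(1) unfolding action_def by auto
      ultimately show ?thesis by simp
    qed
  qed (use assms in \<open>auto simp: action_def\<close>)
  then show ?thesis
    by (simp add: act_def w'_def)
qed

lemma act_closed: "action f Z \<Longrightarrow> z \<in> Z \<Longrightarrow> g \<in> carrier G \<Longrightarrow> act f g z \<in> Z"
proof -
  assume *: "action f Z" "z \<in> Z" "g \<in> carrier G"
  have "foldr f w z \<in> Z" if "w \<in> words V" for w
    using that *(1,2) by (induction w) (auto simp: action_def)
  moreover obtain w where "w \<in> words V" "g = cls w" using * by (auto simp: carrier_eq)
  ultimately show ?thesis using * by (simp add: act_cls[OF *(1)])
qed

lemma act_mult:
  assumes "action f Z" "z \<in> Z" "g \<in> carrier G" "h \<in> carrier G"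
  shows "act f (g \<otimes> h) z = act f g (act f h z)"
proof -
  obtain u v where uv: "u \<in> words V" "v \<in> words V" "g = cls u" "h = cls v"
    using assms by (auto simp: carrier_eq)
  have "act f h z \<in> Z" using assms by (intro act_closed)
  then show ?thesis
    using uv assms(2) by (simp add: mult_cls act_cls[OF assms(1)])
qed

lemma act_one: "action f Z \<Longrightarrow> z \<in> Z \<Longrightarrow> act f \<one> z = z"
  by (simp add: one_eq act_cls[of f Z])

lemma act_gen: "action f Z \<Longrightarrow> z \<in> Z \<Longrightarrow> s \<in> V \<Longrightarrow> act f (gen s b) z = f (s, b) z"
  by (simp add: gen_def act_cls[of f Z])

lemma act_gen_mult:
  assumes "action f Z" "z \<in> Z" "s \<in> V" "h \<in> carrier G"
  shows "act f (gen s b \<otimes> h) z = f (s, b) (act f h z)"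
proof -
  have "act f h z \<in> Z" using assms by (intro act_closed)
  then show ?thesis using assms by (simp add: act_mult[of f Z] act_gen[of f Z])
qed

section \<open>Exponent sums and the abelianisation\<close>

definition expo_step :: "'a \<Rightarrow> 'a \<times> bool \<Rightarrow> int \<Rightarrow> int" where
  "expo_step v l z = z + (if fst l = v then if snd l then 1 else -1 else 0)"

definition expo :: "'a \<Rightarrow> 'a word set \<Rightarrow> int" where
  "expo v g = act (expo_step v) g 0"

lemma action_expo: "action (expo_step v) UNIV"
  by (auto simp: action_def expo_step_def)

lemma expo_one [simp]: "expo v \<one> = 0"
  by (simp add: expo_def act_one[OF action_expo])

lemma expo_gen_mult:
  "s \<in> V \<Longrightarrow> g \<in> carrier G \<Longrightarrow>
    expo v (gen s b \<otimes> g) = (if s = v then if b then 1 else -1 else 0) + expo v g"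
  by (simp add: expo_def act_gen_mult[OF action_expo] expo_step_def)

lemma expo_gen: "s \<in> V \<Longrightarrow> expo v (gen s b) = (if s = v then if b then 1 else -1 else 0)"
  using expo_gen_mult[of s \<one> v b] by simp

lemma expo_mult: "g \<in> carrier G \<Longrightarrow> h \<in> carrier G \<Longrightarrow> expo v (g \<otimes> h) = expo v g + expo v h"
  by (induction rule: carrier_induct) (auto simp: expo_gen_mult m_assoc)

lemma expo_inv: "g \<in> carrier G \<Longrightarrow> expo v (inv g) = - expo v g"
  using expo_mult[of g "inv g" v] by (simp add: r_inv)

lemma expo_pow: "g \<in> carrier G \<Longrightarrow> expo v (g [^] (n::nat)) = int n * expo v g"
  by (induction n) (auto simp: expo_mult algebra_simps)

lemma expo_conj: "g \<in> carrier G \<Longrightarrow> h \<in> carrier G \<Longrightarrow> expo v (inv h \<otimes> g \<otimes> h) = expo v g"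
  by (simp add: expo_mult expo_inv)

lemma expo_sub:
  assumes "g \<in> sub X" "X \<subseteq> V" "v \<notin> X"
  shows "expo v g = 0"
  using assms(1,2) by (induction rule: sub_induct) (use assms(2,3) in \<open>auto simp: expo_gen_mult subset_iff\<close>)

text \<open>Multiply suitable powers of the generators in \<open>X\<close>, one generator for each
  step of the induction. This turns integer combinations of exponent vectors back into group
  elements.\<close>

lemma expo_exists:
  assumes "X \<subseteq> V"
  shows "\<exists>g\<in>sub X. \<forall>t. expo t g = (if t \<in> X then n t else 0)"
proof -
  have "finite X" using assms finite_V finite_subset by blast
  then show ?thesis
    using assms
  proof induction
    case empty
    show ?case by (intro bexI[of _ \<one>]) (auto simp: one_sub)
  next
    case (insert x X)
    interpret subgroup "sub (insert x X)" G
      using insert by (intro subgroup_sub)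
    have ex: "\<exists>h\<in>sub (insert x X). \<forall>t. expo t h = (if t = x then k else 0)" for k
    proof (induction k rule: int_induct[where k = 0])
      case base
      then show ?case by (intro bexI[of _ \<one>]) auto
    next
      case (step1 i)
      then obtain h where h: "h \<in> sub (insert x X)" "\<forall>t. expo t h = (if t = x then i else 0)" by blast
      have "gen x True \<otimes> h \<in> sub (insert x X)" using h by (auto intro: gen_sub)
      moreover have "h \<in> carrier G" using h by (auto intro: mem_carrier)
      ultimately show ?case using h insert by (intro bexI[of _ "gen x True \<otimes> h"]) (auto simp: expo_gen_mult)
    next
      case (step2 i)
      then obtain h where h: "h \<in> sub (insert x X)" "\<forall>t. expo t h = (if t = x then i else 0)" by blast
      have "gen x False \<otimes> h \<in> sub (insert x X)" using h by (auto intro: gen_sub)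
      moreover have "h \<in> carrier G" using h by (auto intro: mem_carrier)
      ultimately show ?case using h insert by (intro bexI[of _ "gen x False \<otimes> h"]) (auto simp: expo_gen_mult)
    qed
    obtain h where h: "h \<in> sub (insert x X)" "\<forall>t. expo t h = (if t = x then n x else 0)"
      using ex by blast
    obtain g where g: "g \<in> sub X" "\<forall>t. expo t g = (if t \<in> X then n t else 0)"
      using insert by auto
    have g': "g \<in> sub (insert x X)" using g sub_mono[of X "insert x X"] by auto
    have "expo t (h \<otimes> g) = (if t \<in> insert x X then n t else 0)" for t
      using h g g' insert by (auto simp: expo_mult mem_carrier)
    then show ?case using h g' by (intro bexI[of _ "h \<otimes> g"]) auto
  qed
qed

text \<open>A homomorphism to the integers factors through the abelianisation, where the exponents
  are the coordinates.\<close>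

lemma additive_eq_sum_expo:
  fixes \<eta> :: "'a word set \<Rightarrow> int"
  assumes "g \<in> carrier G"
    and hom: "\<And>g h. g \<in> carrier G \<Longrightarrow> h \<in> carrier G \<Longrightarrow> \<eta> (g \<otimes> h) = \<eta> g + \<eta> h"
  shows "\<eta> g = (\<Sum>v\<in>V. expo v g * \<eta> (gen v True))"
  using assms(1)
proof (induction rule: carrier_induct)
  case one
  have "\<eta> \<one> = 0" using hom[of \<one> \<one>] by simp
  then show ?case by simp
next
  case (step s b g)
  have "\<eta> \<one> = 0" using hom[of \<one> \<one>] by simp
  then have F: "\<eta> (gen s False) = - \<eta> (gen s True)"
    using hom[of "gen s True" "gen s False"] gen_cancel[of s True] step by simp
  have "(\<Sum>v\<in>V. expo v (gen s b \<otimes> g) * \<eta> (gen v True)) =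
     (\<Sum>v\<in>V. (if s = v then (if b then 1 else -1) * \<eta> (gen v True) else 0) + expo v g * \<eta> (gen v True))"
    using step by (intro sum.cong) (auto simp: expo_gen_mult algebra_simps)
  also have "\<dots> = (if b then 1 else -1) * \<eta> (gen s True) + \<eta> g"
    using step finite_V by (simp add: sum.distrib)
  also have "\<dots> = \<eta> (gen s b) + \<eta> g"
    using F by (cases b) auto
  finally show ?case using step hom by simp
qed

text \<open>The last two coordinates of left multiplication in the Heisenberg group, where \<open>u\<close>, \<open>v\<close> act as
  the two standard generators and all other vertices act trivially.\<close>

definition heis_step :: "'a \<Rightarrow> 'a \<Rightarrow> 'a \<times> bool \<Rightarrow> int \<times> int \<Rightarrow> int \<times> int" where
  "heis_step u v l z =
    (if fst l = u then (fst z, if snd l then snd z + fst z else snd z - fst z)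
     else if fst l = v then (if snd l then fst z + 1 else fst z - 1, snd z) else z)"

text \<open>In the Heisenberg group the commutator of two elements is central and given by the
  determinant of their images in the abelianisation, so it vanishes for commuting elements. The
  action respects the relations because \<open>u\<close> and \<open>v\<close>, whose actions do not
  commute, are not adjacent.\<close>

lemma commute_expo:
  assumes g: "g \<in> carrier G" and h: "h \<in> carrier G" and comm: "g \<otimes> h = h \<otimes> g"
    and uv: "{u, v} \<notin> E" "u \<noteq> v"
  shows "expo u g * expo v h = expo u h * expo v g"
proof -
  let ?f = "heis_step u v"
  have action: "action ?f UNIV"
    using uv by (auto simp: action_def heis_step_def insert_commute)
  \<comment> \<open>Each element acts as a shear followed by a translation: the value at the origin
    and the exponent of \<open>u\<close> determine it.\<close>
  have act: "act ?f g (j, k) = (j + expo v g, k + snd (act ?f g (0, 0)) + expo u g * j)"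
    if "g \<in> carrier G" for g j k
    using that
  proof (induction arbitrary: j k rule: carrier_induct)
    case one
    then show ?case by (simp add: act_one[OF action])
  next
    case (step s b g)
    have "fst (act ?f g (0, 0)) = expo v g"
      by (subst step.IH) simp
    then obtain k0 where k0: "act ?f g (0, 0) = (expo v g, k0)" by (metis prod.collapse)
    show ?case
      using step k0 uv heis_step_def[of u v "(s, b)"]
      by (auto simp: act_gen_mult[OF action] expo_gen_mult algebra_simps)
  qed
  have "snd (act ?f (g \<otimes> h) (0, 0)) =
      snd (act ?f h (0, 0)) + snd (act ?f g (0, 0)) + expo u g * expo v h" if "g \<in> carrier G" "h \<in> carrier G" for g h
  proof -
    have "act ?f (g \<otimes> h) (0, 0) = act ?f g (act ?f h (0, 0))"
      using that by (intro act_mult[OF action]) auto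
    also have "\<dots> = act ?f g (expo v h, snd (act ?f h (0, 0)))"
      using act[OF that(2), of 0 0] by simp
    finally show ?thesis
      by (subst (asm) act[OF that(1)]) simp
  qed
  from this[OF g h] this[OF h g] comm show ?thesis by simp
qed

section \<open>Retractions onto standard subgroups\<close>

definition ret_step :: "'a set \<Rightarrow> 'a \<times> bool \<Rightarrow> 'a word set \<Rightarrow> 'a word set" where
  "ret_step X l g = (if fst l \<in> X then gen (fst l) (snd l) \<otimes> g else g)"

text \<open>The endomorphism that kills the generators outside \<open>X\<close> and fixes the
  others, obtained as the orbit map of \<open>\<one>\<close> when the group acts on itself through
  it.\<close>

definition ret :: "'a set \<Rightarrow> 'a word set \<Rightarrow> 'a word set" where
  "ret X g = act (ret_step X) g \<one>"

lemma action_ret: "action (ret_step X) (carrier G)"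
proof -
  have 1: "gen s b \<otimes> (gen s (\<not> b) \<otimes> z) = z" if "s \<in> V" "z \<in> carrier G" for s b z
    using that gen_cancel[of s b] by (simp flip: m_assoc)
  have 2: "gen s True \<otimes> (gen t True \<otimes> z) = gen t True \<otimes> (gen s True \<otimes> z)"
    if "s \<in> V" "t \<in> V" "{s, t} \<in> E" "z \<in> carrier G" for s t z
    using that gen_commute[of s t True True] by (simp flip: m_assoc)
  show ?thesis
    unfolding action_def ret_step_def
    by (intro conjI ballI allI impI) (simp_all add: 1, metis 2)
qed

lemma ret_one [simp]: "ret X \<one> = \<one>"
  by (simp add: ret_def act_one[OF action_ret])

lemma ret_gen_mult:
  "s \<in> V \<Longrightarrow> g \<in> carrier G \<Longrightarrow>
    ret X (gen s b \<otimes> g) = (if s \<in> X then gen s b \<otimes> ret X g else ret X g)"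
  by (simp add: ret_def act_gen_mult[OF action_ret] ret_step_def)

lemma ret_closed [simp]: "g \<in> carrier G \<Longrightarrow> ret X g \<in> carrier G"
  by (simp add: ret_def act_closed[OF action_ret])

lemma ret_mult: "g \<in> carrier G \<Longrightarrow> h \<in> carrier G \<Longrightarrow> ret X (g \<otimes> h) = ret X g \<otimes> ret X h"
  by (induction rule: carrier_induct) (auto simp: ret_gen_mult m_assoc)

lemma ret_inv: "g \<in> carrier G \<Longrightarrow> ret X (inv g) = inv (ret X g)"
  using ret_mult[of "inv g" g X] by (intro inv_equality[symmetric]) auto

lemma ret_sub:
  assumes "g \<in> sub Y" "Y \<subseteq> V"
  shows "ret X g \<in> sub (X \<inter> Y)"
  using assms
proof (induction rule: sub_induct)
  case one
  then show ?case by (simp add: one_sub)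
next
  case (step s b g)
  interpret subgroup "sub (X \<inter> Y)" G
    using assms by (intro subgroup_sub) auto
  show ?case using step by (auto simp: ret_gen_mult gen_sub)
qed

lemma ret_id: "g \<in> sub X \<Longrightarrow> X \<subseteq> V \<Longrightarrow> ret X g = g"
  by (induction rule: sub_induct) (auto simp: ret_gen_mult)

lemma expo_ret: "g \<in> carrier G \<Longrightarrow> v \<in> X \<Longrightarrow> expo v (ret X g) = expo v g"
  by (induction rule: carrier_induct) (auto simp: ret_gen_mult expo_gen_mult)

lemma sub_link_commute:
  assumes "x \<in> V" "c \<in> sub (link x)"
  shows "c \<otimes> gen x b = gen x b \<otimes> c"
proof -
  have "link x \<subseteq> V" by (auto simp: link_def)
  with assms(2) show ?thesis
  proof (induction rule: sub_induct)
    case (step s b' g)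
    then have s: "s \<in> V" "{s, x} \<in> E" by (auto simp: link_def)
    have "gen s b' \<otimes> g \<otimes> gen x b = gen s b' \<otimes> gen x b \<otimes> g"
      using step s assms by (simp add: m_assoc)
    also have "\<dots> = gen x b \<otimes> (gen s b' \<otimes> g)"
      using step s assms gen_commute[of s x b' b] by (simp flip: m_assoc)
    finally show ?case .
  qed (use assms in auto)
qed

text \<open>The subgroup is cyclic, so an element is the power of the generator given by its
  exponent.\<close>

lemma sub_singleton:
  assumes "v \<in> V" "g \<in> sub {v}" "expo v g = 1"
  shows "g = gen v True"
proof -
  have "{v} \<subseteq> V" using assms by auto
  with assms(2) have "g = gen v True [^] expo v g"
  proof (induction rule: sub_induct)
    case (step s b g)
    have "gen v True [^] (-1 :: int) = gen v False"
      using assms by (simp add: int_pow_neg inv_gen)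
    then have "gen v b = gen v True [^] (if b then 1 else -1 :: int)"
      using assms by simp
    then have "gen v b \<otimes> g = gen v True [^] (if b then 1 else -1 :: int) \<otimes> gen v True [^] expo v g"
      using step by argo
    also have "\<dots> = gen v True [^] ((if b then 1 else -1) + expo v g)"
      using assms by (intro int_pow_mult[symmetric]) auto
    also have "(if b then 1 else -1) + expo v g = expo v (gen v b \<otimes> g)"
      using step assms by (simp add: expo_gen_mult)
    finally show ?case using step by auto
  qed simp
  then show ?thesis using assms by simp
qed

end

section \<open>Reduced words in free groups\<close>

definition flip :: "'o \<times> bool \<Rightarrow> 'o \<times> bool" where
  "flip l = (fst l, \<not> snd l)"

definition reduced :: "('o \<times> bool) list \<Rightarrow> bool" where
  "reduced w = successively (\<lambda>a b. b \<noteq> flip a) w"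

text \<open>Left multiplication of a reduced word by a letter in the free group; iterating it,
  \<open>fmul\<close> multiplies by a whole word and keeps the result reduced.\<close>

definition push :: "'o \<times> bool \<Rightarrow> ('o \<times> bool) list \<Rightarrow> ('o \<times> bool) list" where
  "push a w = (if w \<noteq> [] \<and> hd w = flip a then tl w else a # w)"

definition fmul :: "('o \<times> bool) list \<Rightarrow> ('o \<times> bool) list \<Rightarrow> ('o \<times> bool) list" where
  "fmul u w = foldr push u w"

abbreviation relabel :: "('o \<Rightarrow> 'o) \<Rightarrow> ('o \<times> bool) list \<Rightarrow> ('o \<times> bool) list" where
  "relabel h \<equiv> map (apfst h)"

definition reduced_words :: "'o set \<Rightarrow> ('o \<times> bool) list set" where
  "reduced_words \<Omega> = {w. reduced w \<and> set w \<subseteq> \<Omega> \<times> UNIV}"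

lemma flip_flip [simp]: "flip (flip a) = a"
  by (simp add: flip_def)

lemma reduced_Nil [simp]: "reduced []"
  by (simp add: reduced_def)

lemma reduced_Cons: "reduced (a # w) \<longleftrightarrow> (w = [] \<or> hd w \<noteq> flip a) \<and> reduced w"
  by (auto simp: reduced_def successively_Cons)

lemma reduced_push: "reduced w \<Longrightarrow> reduced (push a w)"
  by (cases w) (auto simp: push_def reduced_Cons)

lemma push_flip: "reduced w \<Longrightarrow> push a (push (flip a) w) = w"
  by (cases w) (auto simp: push_def reduced_Cons neq_Nil_conv)

lemma fmul_Nil [simp]: "fmul [] w = w"
  by (simp add: fmul_def)

lemma fmul_Cons: "fmul (a # u) w = push a (fmul u w)"
  by (simp add: fmul_def)

lemma fmul_append: "fmul (u @ v) w = fmul u (fmul v w)"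
  by (simp add: fmul_def)

lemma reduced_fmul: "reduced w \<Longrightarrow> reduced (fmul u w)"
  by (induction u) (auto simp: fmul_Cons reduced_push)

lemma fmul_push:
  assumes "reduced w"
  shows "fmul (push a u) w = push a (fmul u w)"
proof (cases "u \<noteq> [] \<and> hd u = flip a")
  case True
  then obtain u' where "u = flip a # u'" by (cases u) auto
  then show ?thesis
    using assms by (simp add: push_def[of a "flip a # u'"] fmul_Cons push_flip reduced_fmul)
next
  case False
  then show ?thesis by (auto simp: push_def[of a u] fmul_Cons)
qed

lemma fmul_eq_append: "reduced (u @ w) \<Longrightarrow> fmul u w = u @ w"
  by (induction u) (auto simp: fmul_Cons reduced_Cons push_def)

lemma fmul_Nil_right: "reduced u \<Longrightarrow> fmul u [] = u"
  using fmul_eq_append[of u "[]"] by simp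

text \<open>Cancellation happens only at the junction and takes equally many letters from both
  factors. Hence a short factor can disturb only a short end of a long one.\<close>

lemma fmul_split:
  assumes "reduced u" "reduced w"
  shows "\<exists>j. j \<le> length u \<and> j \<le> length w \<and> fmul u w = take (length u - j) u @ drop j w"
  using assms(1)
proof (induction u)
  case (Cons a u)
  then obtain j where j: "j \<le> length u" "j \<le> length w"
    "fmul u w = take (length u - j) u @ drop j w"
    by (auto simp: reduced_Cons)
  show ?case
  proof (cases "j = length u")
    case False
    then have "take (length u - j) u \<noteq> []" "hd (take (length u - j) u) = hd u" "u \<noteq> []"
      using j by auto
    then have "push a (fmul u w) = a # take (length u - j) u @ drop j w"
      using j Cons.prems by (auto simp: push_def reduced_Cons)
    then show ?thesis
      using j False by (intro exI[of _ j]) (auto simp: fmul_Cons Suc_diff_le)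
  next
    \<comment> \<open>All of \<open>u\<close> has been cancelled, so the new letter meets
      \<open>w\<close> directly and may cancel one further letter.\<close>
    case True
    then have eq: "fmul u w = drop j w" using j by simp
    show ?thesis
    proof (cases "drop j w \<noteq> [] \<and> hd (drop j w) = flip a")
      case True
      then have "push a (drop j w) = drop (Suc j) w" "Suc j \<le> length w"
        by (auto simp: push_def tl_drop drop_Suc)
      then show ?thesis
        using eq \<open>j = length u\<close> by (intro exI[of _ "Suc j"]) (auto simp: fmul_Cons)
    next
      case False
      then have "push a (drop j w) = a # drop j w" by (auto simp: push_def)
      then show ?thesis
        using eq j \<open>j = length u\<close> by (intro exI[of _ j]) (auto simp: fmul_Cons)
    qed
  qed
qed simp

lemma apfst_eq_flip:
  assumes "inj_on h \<Omega>" "fst a \<in> \<Omega>" "fst b \<in> \<Omega>"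
  shows "apfst h b = flip (apfst h a) \<longleftrightarrow> b = flip a"
  using assms by (cases a; cases b) (auto simp: flip_def inj_on_def)

lemma reduced_relabel:
  assumes "inj_on h \<Omega>" "set w \<subseteq> \<Omega> \<times> UNIV" "reduced w"
  shows "reduced (relabel h w)"
  using assms(2,3)
proof (induction w)
  case (Cons a w)
  then show ?case
    using apfst_eq_flip[OF assms(1), of a "hd w"] by (cases w) (auto simp: reduced_Cons)
qed simp

lemma push_relabel:
  assumes "inj_on h \<Omega>" "set w \<subseteq> \<Omega> \<times> UNIV" "fst a \<in> \<Omega>"
  shows "push (apfst h a) (relabel h w) = relabel h (push a w)"
  using assms apfst_eq_flip[OF assms(1), of a "hd w"]
  by (cases w) (auto simp: push_def flip_def)

lemma set_push: "set (push a w) \<subseteq> insert a (set w)"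
  by (cases w) (auto simp: push_def)

lemma set_fmul: "set (fmul u w) \<subseteq> set u \<union> set w"
  by (induction u) (use set_push in \<open>fastforce simp: fmul_Cons\<close>)+

lemma fmul_relabel:
  assumes "inj_on h \<Omega>" "set w \<subseteq> \<Omega> \<times> UNIV" "set u \<subseteq> \<Omega> \<times> UNIV"
  shows "fmul (relabel h u) (relabel h w) = relabel h (fmul u w)"
  using assms(3)
proof (induction u)
  case (Cons a u)
  have "set (fmul u w) \<subseteq> \<Omega> \<times> UNIV" using set_fmul[of u w] Cons assms by auto
  then show ?case
    using Cons push_relabel[OF assms(1), of "fmul u w" a] by (auto simp: fmul_Cons)
qed simp

lemma reduced_words_push: "w \<in> reduced_words \<Omega> \<Longrightarrow> fst a \<in> \<Omega> \<Longrightarrow> push a w \<in> reduced_words \<Omega>"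
  using set_push[of a w] by (cases a) (auto simp: reduced_words_def reduced_push)

lemma reduced_words_relabel:
  assumes "w \<in> reduced_words \<Omega>" "inj_on h \<Omega>" "h ` \<Omega> \<subseteq> \<Omega>"
  shows "relabel h w \<in> reduced_words \<Omega>"
  using assms reduced_relabel[OF assms(2), of w] by (fastforce simp: reduced_words_def)

section \<open>The tree of a vertex\<close>

context raag_graph
begin

lemma link_subset: "link x \<subseteq> V - {x}"
  by (auto simp: link_def)

text \<open>The group is the semidirect product of \<open>sub (V - {x})\<close> and the free group on the cosets of
  \<open>sub (link x)\<close> in it, the coset of \<open>k\<close> standing for the generator \<open>k x k\<inverse>\<close>. The Cayley tree of this
  free group is the Bass--Serre tree; \<open>x\<close> acts on it by multiplication with the trivial coset and the
  other vertices act by permuting the cosets.\<close>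

definition edge_cosets :: "'a \<Rightarrow> 'a word set set set" where
  "edge_cosets x = (\<lambda>k. k <# sub (link x)) ` sub (V - {x})"

definition tree_step :: "'a \<Rightarrow> 'a \<times> bool \<Rightarrow> ('a word set set \<times> bool) list \<Rightarrow> ('a word set set \<times> bool) list" where
  "tree_step x l w = (if fst l = x then push (sub (link x), snd l) w
     else relabel (\<lambda>\<omega>. gen (fst l) (snd l) <# \<omega>) w)"

lemma sub_link_carrier: "sub (link x) \<subseteq> carrier G"
  using sub_carrier[of "link x"] link_subset by blast

lemma sub_Diff_carrier: "k \<in> sub (V - {x}) \<Longrightarrow> k \<in> carrier G"
  using sub_carrier[of "V - {x}"] by blast

lemma edge_cosets_carrier: "\<omega> \<in> edge_cosets x \<Longrightarrow> \<omega> \<subseteq> carrier G"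
  unfolding edge_cosets_def using l_coset_subset_G[OF sub_link_carrier] sub_Diff_carrier by blast

lemma sub_link_edge_cosets: "sub (link x) \<in> edge_cosets x"
  unfolding edge_cosets_def using one_sub lcos_mult_one[OF sub_link_carrier] by (metis imageI)

lemma edge_cosets_mult:
  assumes "g \<in> sub (V - {x})" "\<omega> \<in> edge_cosets x"
  shows "g <# \<omega> \<in> edge_cosets x"
proof -
  interpret subgroup "sub (V - {x})" G by (intro subgroup_sub) auto
  obtain k where "k \<in> sub (V - {x})" "\<omega> = k <# sub (link x)"
    using assms by (auto simp: edge_cosets_def)
  then have "g <# \<omega> = (g \<otimes> k) <# sub (link x)" "g \<otimes> k \<in> sub (V - {x})"
    using assms by (auto simp: lcos_m_assoc[OF sub_link_carrier])
  then show ?thesis by (auto simp: edge_cosets_def)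
qed

lemma inj_on_coset_mult: "g \<in> carrier G \<Longrightarrow> inj_on (\<lambda>\<omega>. g <# \<omega>) (edge_cosets x)"
proof (rule inj_on_inverseI)
  fix \<omega> assume "g \<in> carrier G" "\<omega> \<in> edge_cosets x"
  then show "inv g <# (g <# \<omega>) = \<omega>"
    using edge_cosets_carrier by (simp add: lcos_m_assoc lcos_mult_one)
qed

lemma sub_link_fixed:
  assumes "c \<in> sub (link x)"
  shows "c <# sub (link x) = sub (link x)"
proof -
  interpret subgroup "sub (link x)" G using link_subset by (intro subgroup_sub) auto
  have "y = c \<otimes> (inv c \<otimes> y)" if "y \<in> sub (link x)" for y
    using that assms by (simp flip: m_assoc)
  then show ?thesis using assms by (fastforce simp: l_coset_def)
qed

abbreviation tree_words :: "'a \<Rightarrow> ('a word set set \<times> bool) list set" where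
  "tree_words x \<equiv> reduced_words (edge_cosets x)"

lemma relabel_coset_assoc:
  assumes "set w \<subseteq> edge_cosets x \<times> UNIV" "g \<in> carrier G" "h \<in> carrier G"
  shows "relabel (\<lambda>\<omega>. g <# \<omega>) (relabel (\<lambda>\<omega>. h <# \<omega>) w) = relabel (\<lambda>\<omega>. (g \<otimes> h) <# \<omega>) w"
  using assms edge_cosets_carrier by (auto simp: lcos_m_assoc)

lemma relabel_one:
  assumes "set w \<subseteq> edge_cosets x \<times> UNIV"
  shows "relabel (\<lambda>\<omega>. \<one> <# \<omega>) w = w"
  using assms edge_cosets_carrier by (intro map_idI) (auto simp: lcos_mult_one)

lemma tree_words_relabel:
  assumes "w \<in> tree_words x" "g \<in> sub (V - {x})"
  shows "relabel (\<lambda>\<omega>. g <# \<omega>) w \<in> tree_words x"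
  using assms edge_cosets_mult inj_on_coset_mult sub_Diff_carrier
  by (intro reduced_words_relabel) auto

text \<open>Vertices other than \<open>x\<close> act through left multiplication of cosets, which
  respects the relations among them. A neighbour of \<open>x\<close> fixes the trivial coset and
  therefore commutes with pushing it.\<close>

lemma action_tree: "action (tree_step x) (tree_words x)"
proof -
  have closed: "tree_step x (s, b) w \<in> tree_words x" if "s \<in> V" "w \<in> tree_words x" for s b w
    using that tree_words_relabel gen_sub[of s "V - {x}"]
    by (auto simp: tree_step_def sub_link_edge_cosets intro!: reduced_words_push)
  have cancel: "tree_step x (s, b) (tree_step x (s, \<not> b) w) = w" if "s \<in> V" "w \<in> tree_words x" for s b w
  proof (cases "s = x")
    case True
    then show ?thesis
      using that push_flip[of w "(sub (link x), b)"]
      by (simp add: tree_step_def flip_def reduced_words_def)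
  next
    case False
    have w: "set w \<subseteq> edge_cosets x \<times> UNIV" using that by (auto simp: reduced_words_def)
    then show ?thesis
      using that False relabel_coset_assoc[OF w, of "gen s b" "gen s (\<not> b)"]
      by (simp add: tree_step_def gen_cancel relabel_one del: map_map)
  qed
  have cross: "tree_step x (x, True) (tree_step x (t, True) w) = tree_step x (t, True) (tree_step x (x, True) w)"
    if "t \<in> V" "t \<noteq> x" "{t, x} \<in> E" "w \<in> tree_words x" for t w
  proof -
    have "gen t True <# sub (link x) = sub (link x)"
      using that by (intro sub_link_fixed gen_sub) (auto simp: link_def)
    then show ?thesis
      using that push_relabel[OF inj_on_coset_mult[of "gen t True" x], of w "(sub (link x), True)"]
      by (simp add: tree_step_def reduced_words_def sub_link_edge_cosets)
  qed
  have rel: "tree_step x (s, True) (tree_step x (t, True) w) = tree_step x (t, True) (tree_step x (s, True) w)"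
    if "s \<in> V" "t \<in> V" "{s, t} \<in> E" "w \<in> tree_words x" for s t w
  proof (cases "s = x \<or> t = x")
    case True
    then show ?thesis
      using that cross[of s w] cross[of t w] by (cases "s = t") (auto simp: insert_commute)
  next
    case False
    have w: "set w \<subseteq> edge_cosets x \<times> UNIV" using that by (auto simp: reduced_words_def)
    show ?thesis
      using False that relabel_coset_assoc[OF w, of "gen s True" "gen t True"]
        relabel_coset_assoc[OF w, of "gen t True" "gen s True"] gen_commute[of s t True True]
      by (simp add: tree_step_def del: map_map)
  qed
  show ?thesis
    unfolding action_def using closed cancel rel by blast
qed

text \<open>The translate of the base vertex \<open>[]\<close>, which is also the geodesic leading
  to it: the component of \<open>g\<close> in the free normal factor. Its length is the displacement
  of the base vertex.\<close>

definition cocycle :: "'a \<Rightarrow> 'a word set \<Rightarrow> ('a word set set \<times> bool) list" where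
  "cocycle x g = act (tree_step x) g []"

abbreviation rot :: "'a \<Rightarrow> 'a word set \<Rightarrow> 'a word set set \<Rightarrow> 'a word set set" where
  "rot x g \<omega> \<equiv> ret (V - {x}) g <# \<omega>"

lemma Nil_tree_words: "[] \<in> tree_words x"
  by (simp add: reduced_words_def)

lemma cocycle_tree_words: "g \<in> carrier G \<Longrightarrow> cocycle x g \<in> tree_words x"
  unfolding cocycle_def by (intro act_closed[OF action_tree] Nil_tree_words)

lemma cocycle_gen_mult:
  "s \<in> V \<Longrightarrow> g \<in> carrier G \<Longrightarrow> cocycle x (gen s b \<otimes> g) = tree_step x (s, b) (cocycle x g)"
  unfolding cocycle_def by (intro act_gen_mult[OF action_tree] Nil_tree_words)

lemma cocycle_one [simp]: "cocycle x \<one> = []"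
  unfolding cocycle_def by (intro act_one[OF action_tree] Nil_tree_words)

lemma ret_Diff: "g \<in> carrier G \<Longrightarrow> ret (V - {x}) g \<in> sub (V - {x})"
  using ret_sub[of g V "V - {x}"] by (simp add: sub_V Int_absorb2)

text \<open>The multiplication rule of a semidirect product: the free component of \<open>h\<close>
  is twisted by the image of \<open>g\<close> after killing \<open>x\<close>.\<close>

lemma cocycle_mult:
  assumes "g \<in> carrier G" "h \<in> carrier G"
  shows "cocycle x (g \<otimes> h) = fmul (cocycle x g) (relabel (rot x g) (cocycle x h))"
  using assms(1)
proof (induction rule: carrier_induct)
  case one
  then show ?case
    using cocycle_tree_words[OF assms(2), of x] assms(2)
    by (simp add: relabel_one[of _ x] reduced_words_def)
next
  case (step s b g)
  let ?h = "relabel (rot x g) (cocycle x h)"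
  have h: "?h \<in> tree_words x"
    using step assms by (intro tree_words_relabel cocycle_tree_words ret_Diff)
  have *: "cocycle x (gen s b \<otimes> g \<otimes> h) = tree_step x (s, b) (fmul (cocycle x g) ?h)"
    using step assms by (simp add: m_assoc cocycle_gen_mult)
  show ?case
  proof (cases "s = x")
    case True
    then show ?thesis
      using h step unfolding *
      by (simp add: cocycle_gen_mult tree_step_def fmul_push reduced_words_def ret_gen_mult)
  next
    case False
    have "relabel (rot x (gen s b \<otimes> g)) (cocycle x h) = relabel (\<lambda>\<omega>. gen s b <# \<omega>) ?h"
      using relabel_coset_assoc[of "cocycle x h" x "gen s b" "ret (V - {x}) g"]
        cocycle_tree_words[OF assms(2), of x] step False
      by (simp add: ret_gen_mult reduced_words_def del: map_map)
    moreover have "fmul (relabel (\<lambda>\<omega>. gen s b <# \<omega>) (cocycle x g)) (relabel (\<lambda>\<omega>. gen s b <# \<omega>) ?h)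
        = relabel (\<lambda>\<omega>. gen s b <# \<omega>) (fmul (cocycle x g) ?h)"
      using h cocycle_tree_words[of g x] step
      by (intro fmul_relabel[OF inj_on_coset_mult[of _ x]]) (auto simp: reduced_words_def)
    ultimately show ?thesis
      using False step unfolding * by (simp add: cocycle_gen_mult tree_step_def del: map_map)
  qed
qed

lemma cocycle_sub: "g \<in> sub (V - {x}) \<Longrightarrow> cocycle x g = []"
proof -
  assume "g \<in> sub (V - {x})"
  moreover have "V - {x} \<subseteq> V" by auto
  ultimately show ?thesis
    by (induction rule: sub_induct) (auto simp: cocycle_gen_mult tree_step_def)
qed

text \<open>Evaluates a word of the free factor in the group, reading a letter labelled by the coset
  of \<open>k\<close> as a conjugate of \<open>x\<close> or its inverse by \<open>k\<close>. A
  relation is used so that no coset representatives have to be chosen.\<close>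

primrec represents :: "'a \<Rightarrow> ('a word set set \<times> bool) list \<Rightarrow> 'a word set \<Rightarrow> bool" where
  "represents x [] y \<longleftrightarrow> y = \<one>"
| "represents x (l # w) y \<longleftrightarrow> (\<exists>k\<in>sub (V - {x}). \<exists>y'\<in>carrier G. fst l = k <# sub (link x) \<and>
    represents x w y' \<and> y = k \<otimes> gen x (snd l) \<otimes> inv k \<otimes> y')"

lemma represents_relabel:
  assumes "represents x w y" "x \<in> V" "h \<in> sub (V - {x})" "y \<in> carrier G"
  shows "represents x (relabel (\<lambda>\<omega>. h <# \<omega>) w) (h \<otimes> y \<otimes> inv h)"
  using assms(1,4)
proof (induction w arbitrary: y)
  case Nil
  then show ?case using assms sub_Diff_carrier by auto
next
  case (Cons l w)
  have h: "h \<in> carrier G" using assms sub_Diff_carrier by auto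
  interpret subgroup "sub (V - {x})" G by (intro subgroup_sub) auto
  obtain k y' where k: "k \<in> sub (V - {x})" "y' \<in> carrier G" "fst l = k <# sub (link x)"
    "represents x w y'" "y = k \<otimes> gen x (snd l) \<otimes> inv k \<otimes> y'"
    using Cons by auto
  have kc: "k \<in> carrier G" using k sub_Diff_carrier by auto
  have cancel: "inv h \<otimes> (h \<otimes> z) = z" if "z \<in> carrier G" for z
    using that h by (simp flip: m_assoc)
  have eq: "h \<otimes> y \<otimes> inv h = h \<otimes> k \<otimes> gen x (snd l) \<otimes> inv (h \<otimes> k) \<otimes> (h \<otimes> y' \<otimes> inv h)"
    using k kc h assms by (simp add: m_assoc inv_mult_group cancel)
  have "h <# fst l = (h \<otimes> k) <# sub (link x)"
    using h kc k by (simp add: lcos_m_assoc[OF sub_link_carrier])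
  moreover have "represents x (relabel (\<lambda>\<omega>. h <# \<omega>) w) (h \<otimes> y' \<otimes> inv h)"
    using Cons k by blast
  ultimately show ?case
    unfolding eq list.map represents.simps using k h assms
    by (intro bexI[of _ "h \<otimes> k"] bexI[of _ "h \<otimes> y' \<otimes> inv h"]) auto
qed

text \<open>The factorisation of the semidirect product, built up letter by letter. It shows that
  the tree loses no information beyond the factor in \<open>sub (V - {x})\<close>.\<close>

lemma cocycle_represents:
  assumes "g \<in> carrier G" "x \<in> V"
  shows "\<exists>y\<in>carrier G. \<exists>b\<in>sub (V - {x}). represents x (cocycle x g) y \<and> g = y \<otimes> b"
  using assms(1)
proof (induction rule: carrier_induct)
  case one
  then show ?case using one_sub by (intro bexI[of _ \<one>]) auto
next
  case (step s e g)
  interpret subgroup "sub (V - {x})" G by (intro subgroup_sub) auto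
  obtain y b where y: "y \<in> carrier G" "b \<in> sub (V - {x})" "represents x (cocycle x g) y" "g = y \<otimes> b"
    using step by blast
  have b: "b \<in> carrier G" using y sub_Diff_carrier by auto
  show ?case
  proof (cases "s = x")
    case False
    define h where "h = gen s e"
    have h: "h \<in> sub (V - {x})" "h \<in> carrier G"
      unfolding h_def using False step by (auto intro: gen_sub)
    have "h \<otimes> g = (h \<otimes> y \<otimes> inv h) \<otimes> (h \<otimes> b)"
      using y h b by (simp add: m_assoc) (simp flip: m_assoc)
    moreover have "represents x (cocycle x (h \<otimes> g)) (h \<otimes> y \<otimes> inv h)"
      using represents_relabel[OF y(3) assms(2) h(1) y(1)] False step
      by (simp add: h_def cocycle_gen_mult tree_step_def)
    ultimately show ?thesis
      using y h b unfolding h_def[symmetric]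
      by (intro bexI[of _ "h \<otimes> y \<otimes> inv h"] bexI[of _ "h \<otimes> b"]) auto
  next
    case True
    let ?C = "sub (link x)"
    have *: "cocycle x (gen s e \<otimes> g) = push (?C, e) (cocycle x g)"
      using step True by (simp add: cocycle_gen_mult tree_step_def)
    show ?thesis
    proof (cases "cocycle x g \<noteq> [] \<and> hd (cocycle x g) = flip (?C, e)")
      case False
      then have "cocycle x (gen s e \<otimes> g) = (?C, e) # cocycle x g"
        using * by (auto simp: push_def)
      moreover have "represents x ((?C, e) # cocycle x g) (gen x e \<otimes> y)"
        using y assms one_sub lcos_mult_one[OF sub_link_carrier] unfolding represents.simps
        by (intro bexI[of _ \<one>] bexI[of _ y]) auto
      ultimately show ?thesis
        using y True assms b by (intro bexI[of _ "gen x e \<otimes> y"] bexI[of _ b]) (auto simp: m_assoc)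
    next
      case cancel: True
      then obtain w where w: "cocycle x g = (?C, \<not> e) # w"
        by (cases "cocycle x g") (auto simp: flip_def)
      have cw: "cocycle x (gen s e \<otimes> g) = w"
        using * w by (auto simp: push_def flip_def)
      obtain k y' where k: "k \<in> sub (V - {x})" "y' \<in> carrier G" "?C = k <# ?C"
        "represents x w y'" "y = k \<otimes> gen x (\<not> e) \<otimes> inv k \<otimes> y'"
        using y w by auto
      have kc: "k \<in> carrier G" using k sub_Diff_carrier by auto
      \<comment> \<open>The cancelled letter carries the trivial coset, so its representative lies
        in the link subgroup and commutes with \<open>x\<close>; the letter thus cancels in the
        group as well.\<close>
      have "k \<otimes> \<one> \<in> k <# ?C" using one_sub by (auto simp: l_coset_def)
      then have "k \<in> ?C" using k kc by simp
      then have "k \<otimes> gen x (\<not> e) = gen x (\<not> e) \<otimes> k"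
        using sub_link_commute assms by auto
      then have "y = gen x (\<not> e) \<otimes> y'"
        using k kc assms by (simp add: m_assoc)
      then have "gen x e \<otimes> y = y'"
        using k assms gen_cancel[of x e] by (simp flip: m_assoc)
      then have "gen s e \<otimes> g = y' \<otimes> b"
        using y b assms True by (simp flip: m_assoc)
      then show ?thesis
        using k y cw by (intro bexI[of _ y'] bexI[of _ b]) auto
    qed
  qed
qed

text \<open>Identifies the stabiliser of the base vertex: with an empty free component the
  factorisation leaves only the factor in \<open>sub (V - {x})\<close>.\<close>

lemma cocycle_eq_Nil_iff:
  assumes "g \<in> carrier G" "x \<in> V"
  shows "cocycle x g = [] \<longleftrightarrow> g \<in> sub (V - {x})"
  using cocycle_represents[OF assms] cocycle_sub sub_Diff_carrier by auto


text \<open>After killing \<open>x\<close>, an element fixing the coset of \<open>k\<close> is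
  conjugate by \<open>k\<close> into the link subgroup, and conjugation preserves exponents. This is
  the obstruction to fixing an edge used throughout.\<close>

lemma coset_fixed_expo:
  assumes "g \<in> carrier G" "\<omega> \<in> edge_cosets x" "rot x g \<omega> = \<omega>" "v \<in> V - {x}" "v \<notin> link x"
  shows "expo v g = 0"
proof -
  let ?r = "ret (V - {x}) g"
  obtain k where k: "k \<in> carrier G" "\<omega> = k <# sub (link x)"
    using assms sub_Diff_carrier by (auto simp: edge_cosets_def)
  have "k \<otimes> \<one> \<in> \<omega>" using one_sub k unfolding l_coset_def by blast
  then have "k \<in> \<omega>" using k(1) by simp
  then have "?r \<otimes> k \<in> ?r <# \<omega>" unfolding l_coset_def by blast
  then have "?r \<otimes> k \<in> k <# sub (link x)" using assms(3) k(2) by simp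
  then obtain c where c: "c \<in> sub (link x)" "?r \<otimes> k = k \<otimes> c"
    unfolding l_coset_def by blast
  have "expo v c = 0" using c assms link_subset by (intro expo_sub[of c "link x"]) auto
  then have "expo v (?r \<otimes> k) = expo v k"
    using c k subsetD[OF sub_link_carrier] by (simp add: expo_mult)
  then show ?thesis using assms k by (simp add: expo_mult expo_ret)
qed

text \<open>\<open>k\<close> fixes the vertex of the tree stabilised by \<open>sub (V - {x})\<close>: otherwise \<open>a\<close> would fix an
  edge on the geodesic between this vertex and its translate.\<close>

lemma conj_sub_unique:
  assumes "x \<in> V" "a \<in> sub (V - {x})" "k \<in> carrier G" "inv k \<otimes> a \<otimes> k \<in> sub (V - {x})"
    and u: "u \<in> V - {x}" "u \<notin> link x" "expo u a \<noteq> 0"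
  shows "k \<in> sub (V - {x})"
proof (rule ccontr)
  assume "k \<notin> sub (V - {x})"
  then obtain l w where lw: "cocycle x k = l # w"
    using assms cocycle_eq_Nil_iff by (cases "cocycle x k") auto
  have a: "a \<in> carrier G" using assms sub_Diff_carrier by auto
  have k: "cocycle x k \<in> tree_words x" using assms by (intro cocycle_tree_words)
  \<comment> \<open>The translate by \<open>a k\<close> is computed twice: \<open>a\<close> on the
    left only relabels, while the conjugate of \<open>a\<close> on the right changes
    nothing.\<close>
  have "cocycle x (a \<otimes> k) = relabel (rot x a) (cocycle x k)"
    using a assms by (simp add: cocycle_mult cocycle_sub)
  moreover have "cocycle x (k \<otimes> (inv k \<otimes> a \<otimes> k)) = cocycle x k"
    using a assms k by (subst cocycle_mult) (auto simp: cocycle_sub fmul_Nil_right reduced_words_def)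
  moreover have "k \<otimes> (inv k \<otimes> a \<otimes> k) = a \<otimes> k"
    using a assms by (simp flip: m_assoc)
  ultimately have "rot x a (fst l) = fst l"
    using lw by (cases l) auto
  moreover have "fst l \<in> edge_cosets x" using k lw by (auto simp: reduced_words_def)
  ultimately show False using coset_fixed_expo[OF a] u by blast
qed

section \<open>Minimal displacement and commuting elements\<close>

lemma cocycle_letter:
  assumes "x \<in> V" "k \<in> sub (V - {x})"
  shows "cocycle x (k \<otimes> gen x e \<otimes> inv k) = [(k <# sub (link x), e)]"
proof -
  have k: "k \<in> carrier G" using assms sub_Diff_carrier by auto
  interpret subgroup "sub (V - {x})" G by (intro subgroup_sub) auto
  have "cocycle x (gen x e \<otimes> inv k) = [(sub (link x), e)]"
    using assms k by (simp add: cocycle_gen_mult cocycle_sub tree_step_def push_def)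
  moreover have "ret (V - {x}) k = k" using assms by (intro ret_id) auto
  ultimately show ?thesis
    using assms k by (simp add: m_assoc cocycle_mult[of k] cocycle_sub)
qed

lemma ret_letter:
  assumes "x \<in> V" "k \<in> carrier G"
  shows "ret (V - {x}) (k \<otimes> gen x e \<otimes> inv k) = \<one>"
  using assms ret_gen_mult[of x \<one> "V - {x}" e] by (simp add: ret_mult ret_inv)

lemma rot_mult:
  assumes "\<omega> \<in> edge_cosets x" "g \<in> carrier G" "h \<in> carrier G"
  shows "rot x (g \<otimes> h) \<omega> = rot x g (rot x h \<omega>)"
  using assms edge_cosets_carrier by (simp add: ret_mult lcos_m_assoc)

lemma rot_edge_cosets: "\<omega> \<in> edge_cosets x \<Longrightarrow> g \<in> carrier G \<Longrightarrow> rot x g \<omega> \<in> edge_cosets x"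
  by (intro edge_cosets_mult ret_Diff)

lemma rot_one: "\<omega> \<in> edge_cosets x \<Longrightarrow> rot x \<one> \<omega> = \<omega>"
  using edge_cosets_carrier by (simp add: lcos_mult_one)

text \<open>An element of minimal displacement length that moves the base vertex is twisted cyclically
  reduced, so that its powers run along an axis without cancellation.\<close>

lemma minimal_no_cancel:
  assumes x: "x \<in> V" and a: "a \<in> carrier G" and f: "cocycle x a \<noteq> []"
    and min: "\<And>h. h \<in> carrier G \<Longrightarrow> length (cocycle x a) \<le> length (cocycle x (inv h \<otimes> a \<otimes> h))"
  shows "apfst (rot x a) (hd (cocycle x a)) \<noteq> flip (last (cocycle x a))"
proof
  assume eq: "apfst (rot x a) (hd (cocycle x a)) = flip (last (cocycle x a))"
  have words: "cocycle x a \<in> tree_words x" using a by (intro cocycle_tree_words)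
  obtain s f' where sf: "cocycle x a = s # f'" using f by (cases "cocycle x a") auto
  show False
  proof (cases f' rule: rev_cases)
    case Nil
    \<comment> \<open>Relabelling keeps the sign of a letter, whereas \<open>flip\<close> reverses
      it.\<close>
    then show ?thesis using eq sf by (cases s) (auto simp: flip_def)
  next
    case (snoc m t)
    obtain k where k: "k \<in> sub (V - {x})" "fst s = k <# sub (link x)"
      using words sf by (auto simp: reduced_words_def edge_cosets_def)
    have kc: "k \<in> carrier G" using k sub_Diff_carrier by auto
    \<comment> \<open>\<open>h\<close> is the free generator spelled by the first letter
      \<open>s\<close>. Conjugating by it cancels a letter at each end, so the displacement drops by
      two.\<close>
    define h where "h = k \<otimes> gen x (snd s) \<otimes> inv k"
    have h: "h \<in> carrier G" using kc x by (simp add: h_def)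
    have ch: "cocycle x h = [s]" using cocycle_letter[OF x k(1)] k by (simp add: h_def prod_eq_iff)
    have inv_h: "inv h = k \<otimes> gen x (\<not> snd s) \<otimes> inv k"
      using kc x by (simp add: h_def inv_mult_group inv_gen m_assoc)
    have ch': "cocycle x (inv h) = [flip s]"
      using cocycle_letter[OF x k(1)] k by (simp add: inv_h flip_def)
    have "cocycle x (a \<otimes> h) = fmul ((s # m) @ [t]) [flip t]"
      using a h ch sf eq snoc by (simp add: cocycle_mult)
    also have "\<dots> = fmul (s # m) []"
      by (simp only: fmul_append) (simp add: fmul_Cons push_def)
    also have "\<dots> = s # m"
      using words sf snoc
      by (intro fmul_Nil_right) (auto simp: reduced_words_def reduced_def successively_append_iff successively_Cons)
    finally have cah: "cocycle x (a \<otimes> h) = s # m" .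
    have "cocycle x (inv h \<otimes> (a \<otimes> h)) = fmul [flip s] (relabel (rot x (inv h)) (s # m))"
      using a h by (simp add: cocycle_mult[of "inv h" "a \<otimes> h"] ch' cah)
    also have "relabel (rot x (inv h)) (s # m) = relabel (\<lambda>\<omega>. \<one> <# \<omega>) (s # m)"
      using ret_letter[OF x kc] by (simp add: inv_h)
    also have "\<dots> = s # m"
      using words sf snoc by (intro relabel_one[of _ x]) (auto simp: reduced_words_def)
    also have "fmul [flip s] (s # m) = m" by (simp add: fmul_Cons push_def)
    finally have "cocycle x (inv h \<otimes> a \<otimes> h) = m" using a h by (simp add: m_assoc)
    then show False using min[OF h] sf snoc by simp
  qed
qed

text \<open>The word \<open>u n\<close> of \<open>a\<^sup>n\<close> is periodic up to relabelling by \<open>a\<close>. Since \<open>b\<close> commutes with \<open>a\<^sup>n\<close>, the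
  middle part of \<open>u n\<close> is also invariant under a shift combined with relabelling by \<open>b\<close>. Comparing \<open>L\<close>
  such shifts with a multiple of the period \<open>L\<close>, some \<open>b\<^sup>L a\<^sup>d\<close> fixes a letter of \<open>u n\<close>.\<close>

lemma commuting_not_hyperbolic:
  assumes x: "x \<in> V" and a: "a \<in> carrier G" and b: "b \<in> carrier G" and comm: "a \<otimes> b = b \<otimes> a"
    and min: "\<And>h. h \<in> carrier G \<Longrightarrow> length (cocycle x a) \<le> length (cocycle x (inv h \<otimes> a \<otimes> h))"
    and v: "v \<in> V - {x}" "v \<notin> link x" "expo v a = 0" "expo v b \<noteq> 0"
  shows "cocycle x a = []"
proof (rule ccontr)
  assume f: "cocycle x a \<noteq> []"
  define f where "f = cocycle x a"
  define L where "L = length f"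
  define u where "u n = cocycle x (a [^] (n::nat))" for n
  define \<beta> :: "'a word set \<Rightarrow> 'a word set set \<times> bool \<Rightarrow> 'a word set set \<times> bool"
    where "\<beta> g = apfst (rot x g)" for g
  have L: "L > 0" using f by (simp add: L_def f_def)
  have words_f: "f \<in> tree_words x" unfolding f_def using a by (intro cocycle_tree_words)
  have words_u: "u n \<in> tree_words x" for n unfolding u_def using a by (intro cocycle_tree_words) auto
  have no_cancel: "\<beta> a (hd f) \<noteq> flip (last f)"
    using minimal_no_cancel[OF x a f min] by (simp add: f_def \<beta>_def)
  \<comment> \<open>The first letter is carried along because it decides whether the next junction
    cancels.\<close>
  have "u (Suc n) = f @ map (\<beta> a) (u n) \<and> hd (u (Suc n)) = hd f" for n
  proof (induction n)
    case 0
    then show ?case using a by (simp add: u_def f_def)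
  next
    case (Suc n)
    have *: "u (Suc (Suc n)) = fmul f (map (\<beta> a) (u (Suc n)))"
      using a nat_pow_Suc2[OF a, of "Suc n"]
      by (simp only: u_def f_def \<beta>_def) (use a in \<open>auto intro!: cocycle_mult\<close>)
    have "map (\<beta> a) (u (Suc n)) \<in> tree_words x"
      unfolding \<beta>_def using words_u a by (intro tree_words_relabel ret_Diff)
    moreover have "u (Suc n) \<noteq> []" using Suc f by (simp add: f_def)
    ultimately have "reduced (f @ map (\<beta> a) (u (Suc n)))"
      using words_f no_cancel Suc
      by (auto simp: reduced_words_def reduced_def successively_append_iff hd_map)
    then show ?case using * f by (simp add: fmul_eq_append f_def)
  qed
  then have u_Suc: "u (Suc n) = f @ map (\<beta> a) (u n)" for n by blast
  have len_u: "length (u n) = n * L" for n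
    by (induction n) (auto simp: u_Suc L_def, simp add: u_def)
  have prefix: "u (Suc n) ! i = u n ! i" if "i < n * L" for i n
    using that
  proof (induction n arbitrary: i)
    case (Suc n)
    show ?case
    proof (cases "i < L")
      case True
      then show ?thesis by (simp add: u_Suc[of n] u_Suc[of "Suc n"] nth_append L_def)
    next
      case False
      then have "i - L < n * L" using Suc by simp
      moreover have "u (Suc m) ! i = \<beta> a (u m ! (i - L))" if "i - L < m * L" for m
        using False that len_u[of m] by (simp add: u_Suc nth_append flip: L_def)
      ultimately show ?thesis
        using Suc.IH[of "i - L"] by simp
    qed
  qed simp
  have period: "u n ! (i + L) = \<beta> a (u n ! i)" if "i + L < n * L" for i n
  proof (cases n)
    case (Suc m)
    then have i: "i < m * L" using that by simp
    then have "u (Suc m) ! (i + L) = \<beta> a (u m ! i)"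
      using len_u[of m] by (simp add: u_Suc nth_append L_def)
    then show ?thesis using prefix[OF i] Suc by simp
  qed (use that in simp)
  have coset: "fst (u n ! i) \<in> edge_cosets x" if "i < n * L" for n i
  proof -
    have "u n ! i \<in> set (u n)" using that len_u[of n] by simp
    then have "u n ! i \<in> edge_cosets x \<times> UNIV"
      using words_u[of n] unfolding reduced_words_def by blast
    then show ?thesis by (simp add: mem_Times_iff)
  qed
  have \<beta>_mult: "\<beta> (g \<otimes> h) l = \<beta> g (\<beta> h l)"
    if "fst l \<in> edge_cosets x" "g \<in> carrier G" "h \<in> carrier G" for g h l
    using that rot_mult[of "fst l" x g h] by (cases l) (simp add: \<beta>_def)
  have \<beta>_coset: "fst (\<beta> g l) \<in> edge_cosets x" if "fst l \<in> edge_cosets x" "g \<in> carrier G" for g l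
    using that by (simp add: \<beta>_def rot_edge_cosets)
  have \<beta>_one: "\<beta> \<one> l = l" if "fst l \<in> edge_cosets x" for l
    using that rot_one[of "fst l" x] by (cases l) (simp add: \<beta>_def)
  have periods: "u n ! (i + d * L) = \<beta> (a [^] d) (u n ! i)" if "i + d * L < n * L" for n i d
    using that
  proof (induction d)
    case 0
    then show ?case using coset \<beta>_one by simp
  next
    case (Suc d)
    have "u n ! (i + Suc d * L) = \<beta> a (u n ! (i + d * L))"
      using period[of "i + d * L" n] Suc.prems by (simp add: algebra_simps)
    then show ?case
      using Suc coset[of i n] a nat_pow_Suc2[OF a, of d] by (simp add: \<beta>_mult)
  qed
  define k where "k = length (cocycle x b)"
  \<comment> \<open>Large enough that a position remains after margins of width
    \<open>k * (L + 1)\<close> are removed at both ends of \<open>u n\<close>.\<close>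
  define n where "n = 2 * (L + 1) * k + 1"
  define N where "N = n * L"
  have words_b: "cocycle x b \<in> tree_words x" using b by (intro cocycle_tree_words)
  have comm_n: "b \<otimes> a [^] n = a [^] n \<otimes> b"
  proof (induction n)
    case (Suc n)
    have "b \<otimes> a [^] Suc n = b \<otimes> a [^] n \<otimes> a" using a b by (simp add: m_assoc)
    also have "\<dots> = a [^] n \<otimes> (a \<otimes> b)" using Suc a b comm by (simp add: m_assoc)
    finally show ?case using a b by (simp add: m_assoc)
  qed (use b in simp)
  \<comment> \<open>Both orders of the product of \<open>b\<close> and the \<open>n\<close>-th power
    of \<open>a\<close> give the same word, and by \<open>fmul_split\<close> each computation
    disturbs at most \<open>k\<close> letters at one end of \<open>u n\<close>.\<close>
  have "fmul (cocycle x b) (map (\<beta> b) (u n)) = fmul (u n) (map (\<beta> (a [^] n)) (cocycle x b))"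
    using arg_cong[OF comm_n, of "cocycle x"] a b by (simp add: cocycle_mult u_def \<beta>_def)
  moreover have "map (\<beta> b) (u n) \<in> tree_words x" "map (\<beta> (a [^] n)) (cocycle x b) \<in> tree_words x"
    unfolding \<beta>_def using words_u words_b a b by (auto intro!: tree_words_relabel ret_Diff)
  ultimately obtain j j' where j: "j \<le> k" "j \<le> N" "j' \<le> k" "j' \<le> N"
    and split: "take (k - j) (cocycle x b) @ drop j (map (\<beta> b) (u n)) =
      take (N - j') (u n) @ drop j' (map (\<beta> (a [^] n)) (cocycle x b))"
    using fmul_split[of "cocycle x b" "map (\<beta> b) (u n)"]
      fmul_split[of "u n" "map (\<beta> (a [^] n)) (cocycle x b)"] words_u[of n] words_b len_u[of n]
    by (auto simp: reduced_words_def N_def k_def)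
  \<comment> \<open>On the left \<open>u n\<close> loses \<open>j\<close> letters and is preceded by
    \<open>k - j\<close> letters of \<open>cocycle x b\<close>, so its positions move by
    \<open>2 * j - k\<close>, which may be negative.\<close>
  have shift: "u n ! i = \<beta> b (u n ! (i + 2 * j - k))" if i: "k \<le> i" "i + k < N" for i
  proof -
    have len: "length (u n) = N" using len_u by (simp add: N_def)
    have "i < N - j'" "\<not> i < k - j" "j + (i - (k - j)) < N" using i j by auto
    moreover from this have "u n ! i = (take (N - j') (u n) @ drop j' (map (\<beta> (a [^] n)) (cocycle x b))) ! i"
      using len by (simp add: nth_append)
    ultimately have "u n ! i = \<beta> b (u n ! (j + (i - (k - j))))"
      using len j unfolding split[symmetric] by (simp add: nth_append k_def ac_simps)
    moreover have "j + (i - (k - j)) = i + 2 * j - k" using i j by simp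
    ultimately show ?thesis by metis
  qed
  \<comment> \<open>A single shift moves a position by at most \<open>k\<close>, so each further
    shift costs another margin of width \<open>k\<close> at both ends.\<close>
  have shifts: "u n ! i = \<beta> (b [^] m) (u n ! (i + 2 * j * m - k * m))"
    if "k * Suc m \<le> i" "i + k * Suc m < N" for i m
    using that
  proof (induction m)
    case 0
    then show ?case using coset[of i n] \<beta>_one by (simp add: N_def)
  next
    case (Suc m)
    define i' where "i' = i + 2 * j * m - k * m"
    define P Q where "P = j * m" and "Q = k * m"
    have jk: "P \<le> Q" using j by (simp add: P_def Q_def)
    have eqs: "2 * j * m = 2 * P" "k * m = Q" "k * Suc m = k + Q" "k * Suc (Suc m) = k + k + Q"
      "2 * j * Suc m = 2 * P + 2 * j"
      by (simp_all add: P_def Q_def)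
    have i': "k \<le> i'" "i' + k < N" using Suc.prems jk unfolding i'_def eqs by linarith+
    have "u n ! i = \<beta> (b [^] m) (u n ! i')"
      using Suc unfolding i'_def by simp
    also have "u n ! i' = \<beta> b (u n ! (i' + 2 * j - k))"
      using shift i' by blast
    also have "i' + 2 * j - k = i + 2 * j * Suc m - k * Suc m"
      using Suc.prems i' jk j unfolding i'_def eqs by linarith
    also have "\<beta> (b [^] m) (\<beta> b (u n ! (i + 2 * j * Suc m - k * Suc m))) =
        \<beta> (b [^] Suc m) (u n ! (i + 2 * j * Suc m - k * Suc m))"
    proof -
      have "i + 2 * j * Suc m - k * Suc m < N"
        using Suc.prems jk j unfolding eqs by linarith
      then show ?thesis using b coset[of _ n] by (simp add: \<beta>_mult N_def)
    qed
    finally show ?case .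
  qed
  have fixed: False if "fst l \<in> edge_cosets x" "g \<in> carrier G" "\<beta> g l = l" "expo v g \<noteq> 0" for l g
    using coset_fixed_expo[OF that(2,1)] that v by (cases l) (auto simp: \<beta>_def)
  define i where "i = k * Suc L"
  have "i + k * Suc L < n" by (simp add: i_def n_def)
  also have "n \<le> N" using L by (simp add: N_def)
  finally have iN: "i + k * Suc L < N" .
  then have ui: "u n ! i = \<beta> (b [^] L) (u n ! (i + 2 * j * L - k * L))"
    using shifts[of L i] by (simp add: i_def)
  have jL: "2 * j * L \<le> 2 * (k * L)" "k * Suc L = k + k * L" using j by simp_all
  \<comment> \<open>The total shift is \<open>L\<close> times \<open>2 * j - k\<close>, a multiple
    of the period, and is undone by a power of \<open>a\<close>; the cases are its sign. As
    \<open>expo v a = 0\<close>, that power does not affect the nonzero exponent of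
    \<open>v\<close>.\<close>
  show False
  proof (cases "k \<le> 2 * j")
    case True
    define d where "d = 2 * j - k"
    have "d * L = 2 * j * L - k * L" "k * L \<le> 2 * j * L"
      using True by (simp_all add: d_def diff_mult_distrib)
    then have d: "i + 2 * j * L - k * L = i + d * L" "i + d * L < N"
      using iN jL by linarith+
    then have "u n ! i = \<beta> (b [^] L \<otimes> a [^] d) (u n ! i)"
      using ui periods[of i d n] a b coset[of i n] iN by (simp add: N_def \<beta>_mult)
    moreover have "expo v (b [^] L \<otimes> a [^] d) \<noteq> 0"
      using a b v L by (simp add: expo_mult expo_pow)
    ultimately show False
      using fixed[of "u n ! i" "b [^] L \<otimes> a [^] d"] coset[of i n] a b iN by (simp add: N_def)
  next
    case False
    define d where "d = k - 2 * j"
    define i' where "i' = i - d * L"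
    have "d * L = k * L - 2 * j * L" "2 * j * L \<le> k * L"
      using False by (simp_all add: d_def diff_mult_distrib)
    then have i': "i + 2 * j * L - k * L = i'" "i = i' + d * L" "i' < N"
      using iN jL(2) i_def unfolding i'_def by linarith+
    have c: "fst (u n ! i') \<in> edge_cosets x" using i' coset by (simp add: N_def)
    have "\<beta> (a [^] d) (u n ! i') = \<beta> (b [^] L) (u n ! i')"
      using ui i' periods[of i' d n] iN by (simp add: N_def)
    then have "\<beta> (inv (b [^] L)) (\<beta> (a [^] d) (u n ! i')) = \<beta> (inv (b [^] L)) (\<beta> (b [^] L) (u n ! i'))"
      by simp
    then have "\<beta> (inv (b [^] L) \<otimes> a [^] d) (u n ! i') = u n ! i'"
      using a b c by (simp flip: \<beta>_mult add: \<beta>_one)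
    moreover have "expo v (inv (b [^] L) \<otimes> a [^] d) \<noteq> 0"
      using a b v L by (simp add: expo_mult expo_pow expo_inv)
    ultimately show False
      using fixed[OF c, of "inv (b [^] L) \<otimes> a [^] d"] a b by simp
  qed
qed

text \<open>Choose the conjugator for which the base vertex is moved least; the conjugate of
  \<open>a\<close> then fixes the base vertex by \<open>commuting_not_hyperbolic\<close>.\<close>

lemma commuting_common_vertex:
  assumes x: "x \<in> V" and a: "a \<in> carrier G" and b: "b \<in> carrier G" and comm: "a \<otimes> b = b \<otimes> a"
    and u: "u \<in> V - {x}" "u \<notin> link x" "expo u a \<noteq> 0"
    and v: "v \<in> V - {x}" "v \<notin> link x" "expo v a = 0" "expo v b \<noteq> 0"
  shows "\<exists>h\<in>carrier G. inv h \<otimes> a \<otimes> h \<in> sub (V - {x})"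
proof -
  let ?len = "\<lambda>h. length (cocycle x (inv h \<otimes> a \<otimes> h))"
  obtain h where h: "h \<in> carrier G" and min: "\<And>h'. h' \<in> carrier G \<Longrightarrow> ?len h \<le> ?len h'"
    using ex_has_least_nat[of "\<lambda>h. h \<in> carrier G" \<one> ?len] by auto
  let ?a = "inv h \<otimes> a \<otimes> h" and ?b = "inv h \<otimes> b \<otimes> h"
  have "cocycle x ?a = []"
  proof (rule commuting_not_hyperbolic[OF x])
    show "?a \<otimes> ?b = ?b \<otimes> ?a"
      using comm a b h by (intro conj_commute)
    show "length (cocycle x ?a) \<le> length (cocycle x (inv h' \<otimes> ?a \<otimes> h'))" if "h' \<in> carrier G" for h'
      using min[of "h \<otimes> h'"] that h a by (simp add: inv_mult_group m_assoc)
    show "expo v ?a = 0" "expo v ?b \<noteq> 0" using a b h v by (simp_all add: expo_conj)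
  qed (use a b h v in auto)
  then show ?thesis using a h x by (auto simp: cocycle_eq_Nil_iff)
qed

end

section \<open>Graphs with the extension property\<close>

text \<open>One representative for each value of \<open>m\<close> already meets every coset.\<close>

lemma (in group) finite_rcosets:
  assumes "subgroup H G" "finite (m ` carrier G)"
    and eq: "\<And>a b. a \<in> carrier G \<Longrightarrow> b \<in> carrier G \<Longrightarrow> m a = m b \<Longrightarrow> a \<otimes> inv b \<in> H"
  shows "finite (rcosets H)"
proof -
  define rep where "rep y = inv_into (carrier G) m y" for y
  have "rcosets H \<subseteq> (\<lambda>y. H #> rep y) ` (m ` carrier G)"
  proof
    fix X assume "X \<in> rcosets H"
    then obtain a where a: "a \<in> carrier G" "X = H #> a" by (auto simp: RCOSETS_def)
    have b: "rep (m a) \<in> carrier G" "m (rep (m a)) = m a"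
      unfolding rep_def using a by (auto intro: inv_into_into f_inv_into_f)
    then have "a \<in> H #> rep (m a)"
      using eq[of a "rep (m a)"] a assms(1) by (simp add: subgroup.rcos_module is_group)
    then have "H #> rep (m a) = X"
      using repr_independence b assms(1) a by blast
    then show "X \<in> (\<lambda>y. H #> rep y) ` (m ` carrier G)"
      using a by (intro image_eqI[of _ _ "m a"]) auto
  qed
  then show ?thesis using assms(2) finite_surj by blast
qed

context raag_graph
begin

lemma hom_eq_on_gens:
  assumes \<phi>: "\<phi> \<in> hom G G" and \<psi>: "\<psi> \<in> hom G G"
    and eq: "\<And>v. v \<in> V \<Longrightarrow> \<phi> (gen v True) = \<psi> (gen v True)" and "g \<in> carrier G"
  shows "\<phi> g = \<psi> g"
proof -
  interpret \<phi>: group_hom G G \<phi> by unfold_locales (rule \<phi>)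
  interpret \<psi>: group_hom G G \<psi> by unfold_locales (rule \<psi>)
  have gen: "\<phi> (gen v b) = \<psi> (gen v b)" if "v \<in> V" for v b
    using that eq \<phi>.hom_inv[of "gen v True"] \<psi>.hom_inv[of "gen v True"]
    by (cases b) (auto simp: inv_gen)
  show ?thesis
    using assms(4) by (induction rule: carrier_induct) (auto simp: gen)
qed

lemma expo_hom_eq_sum:
  assumes "\<phi> \<in> hom G G" "g \<in> carrier G"
  shows "expo w (\<phi> g) = (\<Sum>v\<in>V. expo v g * expo w (\<phi> (gen v True)))"
  using assms
  by (intro additive_eq_sum_expo) (auto simp: hom_mult expo_mult hom_in_carrier)

text \<open>The retraction killing \<open>x\<close> fixes \<open>k\<close> and maps
  \<open>sub (V - F)\<close> into the smaller standard subgroup.\<close>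

lemma Inter_sub:
  assumes "finite F" "F \<subseteq> V" "k \<in> carrier G" "\<And>x. x \<in> F \<Longrightarrow> k \<in> sub (V - {x})"
  shows "k \<in> sub (V - F)"
  using assms
proof (induction F)
  case empty
  then show ?case by (simp add: sub_V)
next
  case (insert x F)
  then have "ret (V - {x}) k \<in> sub ((V - {x}) \<inter> (V - F))"
    by (intro ret_sub) auto
  moreover have "ret (V - {x}) k = k" using insert by (intro ret_id) auto
  moreover have "(V - {x}) \<inter> (V - F) = V - insert x F" by auto
  ultimately show ?case by simp
qed

text \<open>Records what is retained of an automorphism trivial on the abelianisation, in a form
  that passes to conjugates.\<close>

definition marking :: "('a \<Rightarrow> 'a word set) \<Rightarrow> bool" where
  "marking g \<longleftrightarrow> (\<forall>v\<in>V. g v \<in> carrier G) \<and>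
    (\<forall>u\<in>V. \<forall>v\<in>V. {u, v} \<in> E \<longrightarrow> g u \<otimes> g v = g v \<otimes> g u) \<and>
    (\<forall>v\<in>V. \<forall>w\<in>V. expo w (g v) = (if w = v then 1 else 0))"

lemma marking_closed: "marking g \<Longrightarrow> v \<in> V \<Longrightarrow> g v \<in> carrier G"
  by (simp add: marking_def)

lemma marking_commute:
  "marking g \<Longrightarrow> {u, v} \<in> E \<Longrightarrow> u \<in> V \<Longrightarrow> v \<in> V \<Longrightarrow> g u \<otimes> g v = g v \<otimes> g u"
  unfolding marking_def by blast

lemma marking_expo: "marking g \<Longrightarrow> v \<in> V \<Longrightarrow> w \<in> V \<Longrightarrow> expo w (g v) = (if w = v then 1 else 0)"
  by (simp add: marking_def)

lemma marking_conj:
  assumes g: "marking g" and h: "h \<in> carrier G"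
  shows "marking (\<lambda>v. inv h \<otimes> g v \<otimes> h)"
  unfolding marking_def
proof (intro conjI ballI impI)
  fix u v assume "u \<in> V" "v \<in> V" "{u, v} \<in> E"
  then show "(inv h \<otimes> g u \<otimes> h) \<otimes> (inv h \<otimes> g v \<otimes> h) = (inv h \<otimes> g v \<otimes> h) \<otimes> (inv h \<otimes> g u \<otimes> h)"
    using conj_commute[OF marking_commute[OF g]] h by (simp add: marking_closed[OF g])
qed (use g h in \<open>auto simp: expo_conj marking_closed marking_expo\<close>)

end

text \<open>The case \<open>a = b\<close> is included and yields a neighbour of \<open>a\<close>
  outside the star of \<open>x\<close>.\<close>

locale extension_graph = raag_graph +
  assumes nontrivial: "x \<in> V \<Longrightarrow> \<exists>v\<in>V. v \<noteq> x"
    and extension: "\<lbrakk>a \<in> V; b \<in> V; x \<in> V; x \<noteq> a; x \<noteq> b\<rbrakk> \<Longrightarrow>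
      \<exists>z\<in>V. z \<notin> {a, b, x} \<and> {z, a} \<in> E \<and> {z, b} \<in> E \<and> {z, x} \<notin> E"
begin

section \<open>Common fixed vertices of a marking\<close>

lemma extension_link:
  assumes "a \<in> V" "b \<in> V" "x \<in> V" "x \<noteq> a" "x \<noteq> b"
  obtains z where "z \<in> V - {x}" "z \<notin> link x" "{z, a} \<in> E" "{z, b} \<in> E" "z \<noteq> a" "z \<noteq> b"
  using extension[OF assms] that by (auto simp: link_def)

lemma outside_edge:
  assumes "x \<in> V"
  obtains u v where "u \<in> V - {x}" "u \<notin> link x" "v \<in> V - {x}" "v \<notin> link x" "{u, v} \<in> E" "u \<noteq> v"
proof -
  obtain v0 where v0: "v0 \<in> V" "v0 \<noteq> x" using nontrivial assms by blast
  obtain v where v: "v \<in> V - {x}" "v \<notin> link x"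
    using extension_link[of v0 v0 x] v0 assms by metis
  then obtain u where u: "u \<in> V - {x}" "u \<notin> link x" "{u, v} \<in> E" "u \<noteq> v"
    using extension_link[of v v x] assms by (metis Diff_iff insertI1)
  show ?thesis using that[OF u(1,2) v u(3,4)] .
qed

text \<open>For \<open>w\<close> outside the star of \<open>x\<close>, whatever commutes with
  \<open>g w\<close> preserves its unique fixed vertex. Fixing that vertex therefore spreads along
  edges, and common neighbours outside the star lead everywhere.\<close>

lemma marking_fixes_vertex:
  assumes g: "marking g" and x: "x \<in> V"
  shows "\<exists>h\<in>carrier G. \<forall>v\<in>V - {x}. inv h \<otimes> g v \<otimes> h \<in> sub (V - {x})"
proof -
  obtain u v where uv: "u \<in> V - {x}" "u \<notin> link x" "v \<in> V - {x}" "v \<notin> link x" "{u, v} \<in> E" "u \<noteq> v"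
    using outside_edge[OF x] .
  then have "\<exists>h\<in>carrier G. inv h \<otimes> g u \<otimes> h \<in> sub (V - {x})"
    using g by (intro commuting_common_vertex[OF x, of "g u" "g v" u v] marking_commute)
      (auto simp: marking_closed marking_expo)
  then obtain h where h: "h \<in> carrier G" "inv h \<otimes> g u \<otimes> h \<in> sub (V - {x})"
    by blast
  have spread: "inv h \<otimes> g z \<otimes> h \<in> sub (V - {x})"
    if w: "w \<in> V - {x}" "w \<notin> link x" "inv h \<otimes> g w \<otimes> h \<in> sub (V - {x})"
      and z: "z \<in> V" "{w, z} \<in> E" for w z
  proof (rule conj_sub_unique[OF x w(3) _ _ w(1,2)])
    let ?a = "inv h \<otimes> g w \<otimes> h" and ?k = "inv h \<otimes> g z \<otimes> h"
    have gw: "g w \<in> carrier G" "g z \<in> carrier G" using g w z by (auto simp: marking_def)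
    show k: "?k \<in> carrier G" using gw h by simp
    have "g w \<otimes> g z = g z \<otimes> g w" using g w z by (intro marking_commute) auto
    then have "?a \<otimes> ?k = ?k \<otimes> ?a" using gw h by (intro conj_commute)
    then have "inv ?k \<otimes> ?a \<otimes> ?k = ?a" using gw h by (intro commute_conj) auto
    then show "inv ?k \<otimes> ?a \<otimes> ?k \<in> sub (V - {x})" using w by simp
    show "expo w ?a \<noteq> 0" using g w gw h by (auto simp: expo_conj marking_def)
  qed
  have outside: "inv h \<otimes> g w \<otimes> h \<in> sub (V - {x})" if w: "w \<in> V - {x}" "w \<notin> link x" for w
  proof -
    obtain z where z: "z \<in> V - {x}" "z \<notin> link x" "{z, u} \<in> E" "{z, w} \<in> E"
      using extension_link[of u w x] uv w x by (metis Diff_iff insertI1)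
    then have "inv h \<otimes> g z \<otimes> h \<in> sub (V - {x})"
      using spread[of u z] uv h by (auto simp: insert_commute)
    then show ?thesis using spread[of z w] z w by auto
  qed
  \<comment> \<open>Vertices in the link of \<open>x\<close> come last: each has a neighbour outside
    the star, where the claim is known.\<close>
  have "inv h \<otimes> g w \<otimes> h \<in> sub (V - {x})" if w: "w \<in> V - {x}" for w
  proof -
    obtain z where z: "z \<in> V - {x}" "z \<notin> link x" "{z, w} \<in> E"
      using extension_link[of w w x] w x by (metis Diff_iff insertI1)
    then show ?thesis using spread[of z w] outside[of z] w by auto
  qed
  then show ?thesis using h by blast
qed

text \<open>The image of a suitable conjugator under \<^term>\<open>ret (V - {x})\<close> is again one, because the vertex
  fixed by a single \<open>g u\<close> with \<open>u \<noteq> x\<close> outside the star of \<open>y\<close> is unique.\<close>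

lemma marking_fixes_near_vertex:
  assumes g: "marking g" and y: "y \<in> V" and X: "X \<subseteq> V"
    and fixed: "\<And>x v. x \<in> X \<Longrightarrow> v \<in> V - {x} \<Longrightarrow> g v \<in> sub (V - {x})"
  shows "\<exists>k\<in>carrier G. (\<forall>x\<in>X. k \<in> sub (V - {x})) \<and>
    (\<forall>v\<in>V - {y}. inv k \<otimes> g v \<otimes> k \<in> sub (V - {y}))"
proof -
  have "finite X" using X finite_V finite_subset by blast
  then show ?thesis
    using X fixed
  proof induction
    case empty
    then show ?case using marking_fixes_vertex[OF g y] by blast
  next
    case (insert x X)
    then obtain k where k: "k \<in> carrier G" "\<And>x'. x' \<in> X \<Longrightarrow> k \<in> sub (V - {x'})"
      "\<And>v. v \<in> V - {y} \<Longrightarrow> inv k \<otimes> g v \<otimes> k \<in> sub (V - {y})"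
      by (metis insert_subset insertI2)
    interpret By: subgroup "sub (V - {y})" G by (intro subgroup_sub) auto
    define k' where "k' = ret (V - {x}) k"
    have k': "k' \<in> carrier G" using k by (simp add: k'_def)
    \<comment> \<open>An edge outside the star of \<open>y\<close> has two ends, one of which
      differs from \<open>x\<close>.\<close>
    obtain u where u: "u \<in> V - {y}" "u \<notin> link y" "u \<noteq> x"
      using outside_edge[OF y] by metis
    have gc: "g v \<in> carrier G" if "v \<in> V" for v using g that by (auto simp: marking_def)
    have "ret (V - {x}) (g u) = g u"
      using insert.prems u by (intro ret_id) auto
    then have "inv k' \<otimes> g u \<otimes> k' = ret (V - {x}) (inv k \<otimes> g u \<otimes> k)"
      using k u gc by (simp add: k'_def ret_mult ret_inv)
    also have "\<dots> \<in> sub ((V - {x}) \<inter> (V - {y}))" using k u by (intro ret_sub) auto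
    also have "\<dots> \<subseteq> sub (V - {y})" by (intro sub_mono) auto
    finally have ku: "inv k' \<otimes> g u \<otimes> k' \<in> sub (V - {y})" .
    \<comment> \<open>\<open>m\<close> compares the two conjugators; uniqueness of the vertex fixed
      by \<open>g u\<close> puts it into the vertex group, so \<open>k'\<close> serves for all
      \<open>v\<close> just as \<open>k\<close> does.\<close>
    define m where "m = inv k \<otimes> k'"
    have m: "m \<in> carrier G" "k' = k \<otimes> m"
      using k k' by (auto simp: m_def simp flip: m_assoc)
    have conj: "inv k' \<otimes> g v \<otimes> k' = inv m \<otimes> (inv k \<otimes> g v \<otimes> k) \<otimes> m" if "v \<in> V" for v
      unfolding m(2) using that gc k m by (intro inv_conj_mult)
    have "m \<in> sub (V - {y})"
    proof (rule conj_sub_unique[OF y _ m(1) _ u(1,2), of "inv k \<otimes> g u \<otimes> k"])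
      show "inv m \<otimes> (inv k \<otimes> g u \<otimes> k) \<otimes> m \<in> sub (V - {y})" using ku conj u by simp
      show "expo u (inv k \<otimes> g u \<otimes> k) \<noteq> 0" using g u k gc by (auto simp: expo_conj marking_def)
    qed (use k u in auto)
    then have "inv k' \<otimes> g v \<otimes> k' \<in> sub (V - {y})" if "v \<in> V - {y}" for v
      using conj[of v] that k by auto
    moreover have "k' \<in> sub (V - {x'})" if "x' \<in> insert x X" for x'
    proof (cases "x' = x")
      case True
      then show ?thesis using k by (simp add: k'_def ret_Diff)
    next
      case False
      then have "k' \<in> sub ((V - {x}) \<inter> (V - {x'}))"
        unfolding k'_def using k that by (intro ret_sub) auto
      then show ?thesis using sub_mono[of "(V - {x}) \<inter> (V - {x'})" "V - {x'}"] by auto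
    qed
    ultimately show ?case using k' by blast
  qed
qed

text \<open>The Helly step: the correcting conjugator for a new \<open>y\<close> lies in the vertex
  groups already treated, so it preserves what was achieved there.\<close>

lemma marking_fixes_vertices:
  assumes g: "marking g" and X: "X \<subseteq> V"
  shows "\<exists>h\<in>carrier G. \<forall>x\<in>X. \<forall>v\<in>V - {x}. inv h \<otimes> g v \<otimes> h \<in> sub (V - {x})"
proof -
  have "finite X" using X finite_V finite_subset by blast
  then show ?thesis
    using X
  proof induction
    case empty
    then show ?case by auto
  next
    case (insert y X)
    then obtain h where h: "h \<in> carrier G"
      "\<And>x v. x \<in> X \<Longrightarrow> v \<in> V - {x} \<Longrightarrow> inv h \<otimes> g v \<otimes> h \<in> sub (V - {x})"
      by auto
    obtain k where k: "k \<in> carrier G" "\<And>x. x \<in> X \<Longrightarrow> k \<in> sub (V - {x})"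
      "\<And>v. v \<in> V - {y} \<Longrightarrow> inv k \<otimes> (inv h \<otimes> g v \<otimes> h) \<otimes> k \<in> sub (V - {y})"
      using marking_fixes_near_vertex[OF marking_conj[OF g h(1)], of y X] h insert by auto
    have "inv (h \<otimes> k) \<otimes> g v \<otimes> (h \<otimes> k) \<in> sub (V - {x})" if "x \<in> insert y X" "v \<in> V - {x}" for x v
    proof -
      interpret subgroup "sub (V - {x})" G by (intro subgroup_sub) auto
      have "inv (h \<otimes> k) \<otimes> g v \<otimes> (h \<otimes> k) = inv k \<otimes> (inv h \<otimes> g v \<otimes> h) \<otimes> k"
        using g that h k by (intro inv_conj_mult) (auto simp: marking_def)
      then show ?thesis
        using that h(2)[of x v] k(2)[of x] k(3)[of v] by (cases "x = y") auto
    qed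
    then show ?case using h k by (intro bexI[of _ "h \<otimes> k"]) auto
  qed
qed

text \<open>After conjugation \<open>g v\<close> lies in \<open>sub (V - {x})\<close> for every
  \<open>x\<close> other than \<open>v\<close>, hence in the cyclic group of \<open>v\<close>, where
  its exponent identifies it.\<close>

lemma marking_standard:
  assumes g: "marking g"
  shows "\<exists>h\<in>carrier G. \<forall>v\<in>V. g v = h \<otimes> gen v True \<otimes> inv h"
proof -
  obtain h where h: "h \<in> carrier G"
    "\<And>x v. x \<in> V \<Longrightarrow> v \<in> V - {x} \<Longrightarrow> inv h \<otimes> g v \<otimes> h \<in> sub (V - {x})"
    using marking_fixes_vertices[OF g, of V] by auto
  have "g v = h \<otimes> gen v True \<otimes> inv h" if v: "v \<in> V" for v
  proof -
    have gv: "g v \<in> carrier G" using g v by (auto simp: marking_def)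
    have "inv h \<otimes> g v \<otimes> h \<in> sub (V - (V - {v}))"
    proof (rule Inter_sub)
      show "inv h \<otimes> g v \<otimes> h \<in> sub (V - {x})" if "x \<in> V - {v}" for x
        using h(2)[of x v] that v by blast
    qed (use finite_V gv h(1) in simp_all)
    moreover have "V - (V - {v}) = {v}" using v by auto
    moreover have "expo v (inv h \<otimes> g v \<otimes> h) = 1" using g v gv h by (auto simp: expo_conj marking_def)
    ultimately have "gen v True = inv h \<otimes> g v \<otimes> h" using sub_singleton[OF v] by simp
    then show ?thesis
      using gv h by (simp add: m_assoc) (simp flip: m_assoc)
  qed
  then show ?thesis using h by blast
qed

section \<open>Automorphisms and their matrices on the abelianisation\<close>

lemma torelli_inner:
  assumes \<phi>: "\<phi> \<in> auto G"
    and expo: "\<And>v w. v \<in> V \<Longrightarrow> w \<in> V \<Longrightarrow> expo w (\<phi> (gen v True)) = (if w = v then 1 else 0)"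
  shows "\<phi> \<in> inner_auto G"
proof -
  have hom: "\<phi> \<in> hom G G" and ext: "\<phi> \<in> extensional (carrier G)"
    using \<phi> by (auto simp: auto_def Bij_def)
  have "marking (\<lambda>v. \<phi> (gen v True))"
    unfolding marking_def
  proof (intro conjI ballI impI)
    fix u v assume uv: "u \<in> V" "v \<in> V" "{u, v} \<in> E"
    then show "\<phi> (gen u True) \<otimes> \<phi> (gen v True) = \<phi> (gen v True) \<otimes> \<phi> (gen u True)"
      using gen_commute[OF uv(3,1,2), of True True] by (simp flip: hom_mult[OF hom])
  qed (use expo hom_in_carrier[OF hom] in auto)
  from marking_standard[OF this] obtain h
    where h: "h \<in> carrier G" "\<forall>v\<in>V. \<phi> (gen v True) = h \<otimes> gen v True \<otimes> inv h"
    by (elim bexE)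
  let ?c = "\<lambda>x\<in>carrier G. h \<otimes> x \<otimes> inv h"
  have "?c \<in> hom G G" using conj_in_auto[OF h(1)] by (auto simp: auto_def)
  then have "\<phi> g = ?c g" if "g \<in> carrier G" for g
    using hom_eq_on_gens[OF hom _ _ that] h by simp
  then have "\<phi> = ?c" using ext by (intro extensionalityI[of _ "carrier G"]) auto
  then show ?thesis using h by (auto simp: inner_auto_def)
qed

text \<open>With \<open>X = \<phi> v\<close> and \<open>Y = \<phi> w\<close> commuting, the combination of exponent vectors
  \<open>X\<^sub>p Y - Y\<^sub>p X\<close> is supported in the link of any \<open>p\<close> with \<open>X\<^sub>p \<noteq> 0\<close>, so it is
  realised by an element commuting with \<open>p\<close>. Pulling this back along \<open>\<phi>\<close> forces
  the exponent vector of the preimage of \<open>p\<close> to be a multiple of that of \<open>v\<close>.\<close>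

lemma auto_expo_bounded:
  assumes \<phi>: "\<phi> \<in> auto G" and v: "v \<in> V" and s: "s \<in> V"
  shows "expo s (\<phi> (gen v True)) \<in> {-1, 0, 1}"
proof -
  have hom: "\<phi> \<in> hom G G" and bij: "bij_betw \<phi> (carrier G) (carrier G)"
    using \<phi> by (auto simp: auto_def Bij_def)
  define \<psi> where "\<psi> = inv_into (carrier G) \<phi>"
  have "\<phi> \<in> iso G G" using hom bij by (simp add: iso_def)
  then have \<psi>: "\<psi> \<in> hom G G"
    using iso_set_sym[of \<phi> G] unfolding \<psi>_def iso_def by blast
  have \<psi>\<phi>: "\<psi> (\<phi> g) = g" if "g \<in> carrier G" for g
    using bij that by (simp add: \<psi>_def bij_betw_def)
  have \<phi>\<psi>: "\<phi> (\<psi> g) = g" if "g \<in> carrier G" for g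
    using bij that by (simp add: \<psi>_def bij_betw_def f_inv_into_f)
  have \<phi>c: "\<phi> g \<in> carrier G" and \<psi>c: "\<psi> g \<in> carrier G" if "g \<in> carrier G" for g
    using that hom_in_carrier[OF hom] hom_in_carrier[OF \<psi>] by blast+
  define X where "X = \<phi> (gen v True)"
  have X: "X \<in> carrier G" using v by (simp add: X_def \<phi>c)
  have "\<exists>p\<in>V. expo p X \<noteq> 0"
  proof (rule ccontr)
    assume "\<not> ?thesis"
    then have "expo v (\<psi> X) = 0" using expo_hom_eq_sum[OF \<psi> X, of v] by simp
    then show False using v by (simp add: X_def \<psi>\<phi> expo_gen)
  qed
  then obtain p where p: "p \<in> V" "expo p X \<noteq> 0" by blast
  define z where "z = \<psi> (gen p True)"
  have z: "z \<in> carrier G" using p by (simp add: z_def \<psi>c)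
  have zero: "expo t z = 0" if t: "t \<in> V" "t \<noteq> v" for t
  proof -
    \<comment> \<open>The extension property with \<open>a = b = v\<close> gives a neighbour of
      \<open>v\<close> that is not adjacent to \<open>t\<close>.\<close>
    obtain w where w: "w \<in> V" "{w, v} \<in> E" "w \<noteq> v" "w \<noteq> t" "{t, w} \<notin> E"
      using extension[of v v t] v t by (auto simp: insert_commute)
    define Y where "Y = \<phi> (gen w True)"
    have Y: "Y \<in> carrier G" using w by (simp add: Y_def \<phi>c)
    have XY: "X \<otimes> Y = Y \<otimes> X"
      using gen_commute[OF w(2,1) v] v w by (simp add: X_def Y_def flip: hom_mult[OF hom])
    define n where "n q = expo p X * expo q Y - expo p Y * expo q X" for q
    have n: "n q = 0" if "q \<in> V" "q \<notin> link p" for q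
      using commute_expo[OF X Y XY, of p q] that by (cases "q = p") (auto simp: n_def link_def insert_commute)
    have link: "link p \<subseteq> V" using link_subset by blast
    obtain g where g: "g \<in> sub (link p)" "\<And>q. expo q g = (if q \<in> link p then n q else 0)"
      using expo_exists[OF link, of n] by blast
    have gc: "g \<in> carrier G" using g sub_link_carrier by blast
    have expo_g: "expo q g = n q" if "q \<in> V" for q using g n that by simp
    have "expo q (\<psi> g) = expo p X * expo q (\<psi> Y) - expo p Y * expo q (\<psi> X)" for q
      unfolding expo_hom_eq_sum[OF \<psi> gc] expo_hom_eq_sum[OF \<psi> X] expo_hom_eq_sum[OF \<psi> Y]
      by (simp add: expo_g n_def sum_subtractf sum_distrib_left algebra_simps)
    then have expo_\<psi>g: "expo q (\<psi> g) = (if q = w then expo p X else 0) - (if q = v then expo p Y else 0)" for q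
      using v w by (simp add: X_def Y_def \<psi>\<phi> expo_gen)
    have "\<psi> g \<otimes> z = z \<otimes> \<psi> g"
      using sub_link_commute[OF p(1) g(1), of True] p gc by (simp add: z_def flip: hom_mult[OF \<psi>])
    \<comment> \<open>The left side vanishes because \<open>t\<close> is neither \<open>v\<close>
      nor \<open>w\<close>, while on the right the factor \<open>expo w (\<psi> g)\<close> equals
      \<open>expo p X\<close>, which is nonzero.\<close>
    then have "expo t (\<psi> g) * expo w z = expo w (\<psi> g) * expo t z"
      using w commute_expo[OF \<psi>c[OF gc] z, of t w] by auto
    then show ?thesis using w t p by (auto simp: expo_\<psi>g)
  qed
  \<comment> \<open>Applying \<phi> to \<open>z\<close> writes the unit vector of \<open>p\<close>
    as an integer multiple of the exponent vector of \<open>X\<close>, which is therefore plus or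
    minus that unit vector.\<close>
  have *: "expo v z * expo q X = (if q = p then 1 else 0)" for q
  proof -
    have "expo q (gen p True) = expo q (\<phi> z)" using p by (simp add: z_def \<phi>\<psi>)
    also have "\<dots> = (\<Sum>t\<in>V. if t = v then expo v z * expo q X else 0)"
      unfolding expo_hom_eq_sum[OF hom z] by (intro sum.cong) (auto simp: zero X_def)
    also have "\<dots> = expo v z * expo q X" using v finite_V by simp
    finally show ?thesis using p by (cases "q = p") (auto simp: expo_gen)
  qed
  show ?thesis
  proof (cases "s = p")
    case True
    then have "expo v z * expo s X = 1" using *[of s] by simp
    then have "expo s X = 1 \<or> expo s X = -1" by (auto simp: zmult_eq_1_iff)
    then show ?thesis by (auto simp: X_def)
  next
    case False
    have "expo v z \<noteq> 0" using *[of p] by auto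
    then show ?thesis using False *[of s] by (simp add: X_def)
  qed
qed

text \<open>Only finitely many matrices \<open>m \<phi>\<close> occur, and two automorphisms with
  the same matrix differ by one that is trivial on the abelianisation, hence inner.\<close>

theorem finite_Out: "finite (carrier (Out G))"
proof -
  let ?A = "AutoGroup G"
  interpret A: group ?A by (rule AutoGroup)
  have A_carrier: "carrier ?A = auto G" by (simp add: AutoGroup_def)
  have A_mult: "a \<otimes>\<^bsub>?A\<^esub> b = compose (carrier G) a b" if "a \<in> auto G" "b \<in> auto G" for a b
    using that by (auto simp: AutoGroup_def BijGroup_def auto_def)
  define m where "m \<phi> = (\<lambda>(v, w)\<in>V \<times> V. expo w (\<phi> (gen v True)))" for \<phi>
  have "finite (rcosets\<^bsub>?A\<^esub> inner_auto G)"
  proof (rule A.finite_rcosets)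
    show "subgroup (inner_auto G) ?A"
      using normal_inner_auto by (rule normal_imp_subgroup)
    have "m ` carrier ?A \<subseteq> (V \<times> V) \<rightarrow>\<^sub>E {-1, 0, 1}"
      unfolding A_carrier
    proof (rule image_subsetI)
      fix \<phi> assume "\<phi> \<in> auto G"
      then show "m \<phi> \<in> (V \<times> V) \<rightarrow>\<^sub>E {-1, 0, 1}"
        using auto_expo_bounded[of \<phi>] by (simp add: m_def Pi_iff)
    qed
    then show "finite (m ` carrier ?A)"
      by (rule finite_subset) (use finite_V in \<open>auto intro: finite_PiE\<close>)
  next
    fix \<phi> \<theta> assume "\<phi> \<in> carrier ?A" "\<theta> \<in> carrier ?A" and m: "m \<phi> = m \<theta>"
    then have \<phi>: "\<phi> \<in> auto G" and \<theta>: "\<theta> \<in> auto G" by (simp_all add: A_carrier)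
    define \<tau> where "\<tau> = \<phi> \<otimes>\<^bsub>?A\<^esub> inv\<^bsub>?A\<^esub> \<theta>"
    have \<tau>: "\<tau> \<in> auto G"
      using \<phi> \<theta> unfolding \<tau>_def A_carrier[symmetric] by auto
    have "\<tau> \<otimes>\<^bsub>?A\<^esub> \<theta> = \<phi>"
      using \<phi> \<theta> unfolding \<tau>_def A_carrier[symmetric] by (simp add: A.m_assoc)
    then have \<phi>_eq: "\<phi> = compose (carrier G) \<tau> \<theta>" using A_mult \<tau> \<theta> by simp
    have hom: "\<phi> \<in> hom G G" "\<theta> \<in> hom G G" and surj: "\<theta> ` carrier G = carrier G"
      using \<phi> \<theta> by (auto simp: auto_def Bij_def bij_betw_def)
    have m': "expo w (\<phi> (gen v True)) = expo w (\<theta> (gen v True))" if "v \<in> V" "w \<in> V" for v w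
      using fun_cong[OF m, of "(v, w)"] that by (simp add: m_def)
    have "expo w (\<tau> (gen v True)) = (if w = v then 1 else 0)" if vw: "v \<in> V" "w \<in> V" for v w
    proof -
      \<comment> \<open>The generator is written as \<open>\<theta> h\<close>, so that \<tau> sends
        it to \<open>\<phi> h\<close>; equality of the matrices compares both through the exponents
        of \<open>h\<close>.\<close>
      obtain h where h: "h \<in> carrier G" "\<theta> h = gen v True" using surj vw by (metis gen_closed imageE)
      then have "\<tau> (gen v True) = \<phi> h" by (simp add: \<phi>_eq compose_def)
      moreover have "expo w (\<phi> h) = expo w (\<theta> h)"
        unfolding expo_hom_eq_sum[OF hom(1) h(1)] expo_hom_eq_sum[OF hom(2) h(1)]
        using vw m' by (intro sum.cong) auto
      ultimately show ?thesis using h vw by (simp add: expo_gen)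
    qed
    then show "\<phi> \<otimes>\<^bsub>?A\<^esub> inv\<^bsub>?A\<^esub> \<theta> \<in> inner_auto G"
      using torelli_inner[OF \<tau>] by (simp add: \<tau>_def)
  qed
  then show ?thesis by (simp add: Out_def FactGroup_def)
qed

end

section \<open>Random graphs\<close>

text \<open>Each event reads only its own block of coordinates, and disjoint blocks are
  independent.\<close>

lemma prob_Pi_pmf_blocks:
  fixes Q :: "'z \<Rightarrow> ('i \<Rightarrow> bool) \<Rightarrow> bool"
  assumes K: "finite K" and W: "finite W" and D: "\<And>z. z \<in> W \<Longrightarrow> D z \<subseteq> K"
    and disj: "disjoint_family_on D W"
    and Q: "\<And>z f g. z \<in> W \<Longrightarrow> (\<And>e. e \<in> D z \<Longrightarrow> f e = g e) \<Longrightarrow> Q z f = Q z g"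
  shows "measure_pmf.prob (Pi_pmf K d p) {f. \<forall>z\<in>W. Q z f} =
    (\<Prod>z\<in>W. measure_pmf.prob (Pi_pmf K d p) {f. Q z f})"
proof (cases "W = {}")
  case False
  let ?M = "measure_pmf (Pi_pmf K d p)"
  let ?X = "\<lambda>z f. restrict f (D z)"
  let ?P = "\<lambda>z. PiM (D z) (\<lambda>_. count_space (UNIV :: bool set))"
  let ?A = "\<lambda>z. {h \<in> PiE (D z) (\<lambda>_. UNIV). Q z h}"
  \<comment> \<open>On a finite block the product sigma-algebra is the full power set, so every
    event is measurable.\<close>
  have P: "?P z = count_space (PiE (D z) (\<lambda>_. UNIV))" if "z \<in> W" for z
    using finite_subset[OF D[OF that] K] by (intro count_space_PiM_finite) auto
  have "prob_space.indep_vars ?M ?P ?X W"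
    using prob_space.indep_vars_restrict[OF measure_pmf.prob_space_axioms indep_vars_Pi_pmf[OF K] D disj] by simp
  then have "measure ?M (\<Inter>z\<in>W. ?X z -` ?A z \<inter> space ?M) = (\<Prod>z\<in>W. measure ?M (?X z -` ?A z \<inter> space ?M))"
  proof (rule prob_space.indep_varsD_finite[OF measure_pmf.prob_space_axioms])
    show "?A z \<in> sets (?P z)" if "z \<in> W" for z
      unfolding P[OF that] by auto
  qed (use False W in auto)
  moreover have "?X z -` ?A z \<inter> space ?M = {f. Q z f}" if "z \<in> W" for z
  proof -
    have "Q z (restrict f (D z)) \<longleftrightarrow> Q z f" for f by (rule Q[OF that]) simp
    then show ?thesis by simp
  qed
  moreover have "(\<Inter>z\<in>W. {f. Q z f}) = {f. \<forall>z\<in>W. Q z f}" by auto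
  ultimately show ?thesis by simp
qed simp

lemma finite_complete_edges: "finite V \<Longrightarrow> finite (complete_edges V)"
  by (rule finite_subset[of _ "Pow V"]) (auto simp: complete_edges_def)

lemma pair_complete_edges: "z \<in> V \<Longrightarrow> a \<in> V \<Longrightarrow> z \<noteq> a \<Longrightarrow> {z, a} \<in> complete_edges V"
  by (auto simp: complete_edges_def)

lemma prob_Pi_bernoulli_pattern:
  assumes K: "finite K" "S \<subseteq> K" "c \<in> K - S" and p: "0 \<le> p" "p \<le> 1"
  shows "measure_pmf.prob (Pi_pmf K False (\<lambda>_. bernoulli_pmf p)) {f. (\<forall>e\<in>S. f e) \<and> \<not> f c} =
    p ^ card S * (1 - p)"
proof -
  let ?B = "\<lambda>e. if e = c then {False} else if e \<in> S then {True} else UNIV"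
  let ?P = "\<lambda>e. measure_pmf.prob (bernoulli_pmf p) (?B e)"
  have S: "finite S" "c \<notin> S" using K finite_subset by auto
  have "{f. (\<forall>e\<in>S. f e) \<and> \<not> f c} = Pi K ?B"
    using K by (auto simp: Pi_iff split: if_splits)
  then have "measure_pmf.prob (Pi_pmf K False (\<lambda>_. bernoulli_pmf p)) {f. (\<forall>e\<in>S. f e) \<and> \<not> f c} =
      (\<Prod>e\<in>K. ?P e)"
    by (simp only: measure_Pi_pmf_Pi[OF K(1)])
  also have "\<dots> = (\<Prod>e\<in>insert c S. ?P e)"
    using K by (intro prod.mono_neutral_right) auto
  also have "\<dots> = ?P c * (\<Prod>e\<in>S. ?P e)"
    using S by (rule prod.insert)
  also have "(\<Prod>e\<in>S. ?P e) = (\<Prod>e\<in>S. p)"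
    using S p by (intro prod.cong) (auto simp: measure_pmf_single)
  finally show ?thesis using p by (simp add: measure_pmf_single)
qed

lemma prob_edge_pattern:
  assumes "finite V" "a \<in> V" "b \<in> V" "x \<in> V" "x \<noteq> a" "x \<noteq> b" "z \<in> V - {a, b, x}"
    and p: "0 < p" "p < 1"
  shows "measure_pmf.prob (Pi_pmf (complete_edges V) False (\<lambda>_. bernoulli_pmf p))
    {f. \<not> (f {z, a} \<and> f {z, b} \<and> \<not> f {z, x})} \<le> 1 - p\<^sup>2 * (1 - p)"
proof -
  let ?M = "Pi_pmf (complete_edges V) False (\<lambda>_. bernoulli_pmf p)" and ?S = "{{z, a}, {z, b}}"
  let ?Q = "{f. f {z, a} \<and> f {z, b} \<and> \<not> f {z, x}}"
  have S: "?S \<subseteq> complete_edges V" and x: "{z, x} \<in> complete_edges V - ?S"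
    using assms(1-7) by (auto intro!: pair_complete_edges simp: doubleton_eq_iff)
  \<comment> \<open>The case \<open>a = b\<close> is allowed and makes \<open>?S\<close> a single
    edge, which only raises the probability.\<close>
  have "card ?S \<le> 2" by (simp add: card_insert_if)
  then have "p\<^sup>2 \<le> p ^ card ?S" using p by (intro power_decreasing) auto
  then have "p\<^sup>2 * (1 - p) \<le> p ^ card ?S * (1 - p)" using p by (intro mult_right_mono) auto
  also have "\<dots> = measure_pmf.prob ?M ?Q"
    using prob_Pi_bernoulli_pattern[OF finite_complete_edges[OF assms(1)] S x, of p] p by simp
  finally have "p\<^sup>2 * (1 - p) \<le> measure_pmf.prob ?M ?Q" .
  moreover have "{f. \<not> (f {z, a} \<and> f {z, b} \<and> \<not> f {z, x})} = UNIV - ?Q"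
    by auto
  ultimately show ?thesis
    using measure_pmf.prob_compl[of ?Q ?M] by simp
qed

section \<open>The extension property of a random graph\<close>

definition extension_property :: "'a set \<Rightarrow> 'a set set \<Rightarrow> bool" where
  "extension_property V E \<longleftrightarrow> (\<forall>a\<in>V. \<forall>b\<in>V. \<forall>x\<in>V. x \<noteq> a \<longrightarrow> x \<noteq> b \<longrightarrow>
    (\<exists>z\<in>V. z \<notin> {a, b, x} \<and> {z, a} \<in> E \<and> {z, b} \<in> E \<and> {z, x} \<notin> E))"

text \<open>Different candidates \<open>z\<close> read disjoint sets of edges, so their failures are
  independent, and at least \<open>card V - 3\<close> candidates exist.\<close>

lemma prob_no_extension:
  assumes V: "finite V" and abx: "a \<in> V" "b \<in> V" "x \<in> V" "x \<noteq> a" "x \<noteq> b"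
    and p: "0 < p" "p < 1"
  shows "measure_pmf.prob (Pi_pmf (complete_edges V) False (\<lambda>_. bernoulli_pmf p))
    {f. \<forall>z\<in>V - {a, b, x}. \<not> (f {z, a} \<and> f {z, b} \<and> \<not> f {z, x})}
    \<le> (1 - p\<^sup>2 * (1 - p)) ^ (card V - 3)"
proof -
  let ?W = "V - {a, b, x}" and ?M = "Pi_pmf (complete_edges V) False (\<lambda>_. bernoulli_pmf p)"
  let ?D = "\<lambda>z. {{z, a}, {z, b}, {z, x}}"
  let ?q = "1 - p\<^sup>2 * (1 - p)"
  have q: "0 \<le> ?q" "?q \<le> 1" using p by (auto simp: mult_le_one power_le_one)
  have "measure_pmf.prob ?M {f. \<forall>z\<in>?W. \<not> (f {z, a} \<and> f {z, b} \<and> \<not> f {z, x})} =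
      (\<Prod>z\<in>?W. measure_pmf.prob ?M {f. \<not> (f {z, a} \<and> f {z, b} \<and> \<not> f {z, x})})"
  proof (rule prob_Pi_pmf_blocks[where D = ?D])
    show "?D z \<subseteq> complete_edges V" if "z \<in> ?W" for z
      using that abx by (auto intro!: pair_complete_edges)
    show "disjoint_family_on ?D ?W"
      by (auto simp: disjoint_family_on_def doubleton_eq_iff)
  qed (use V finite_complete_edges in auto)
  also have "\<dots> \<le> (\<Prod>z\<in>?W. ?q)"
    using prob_edge_pattern[OF V abx _ p] by (intro prod_mono) auto
  also have "\<dots> \<le> ?q ^ (card V - 3)"
  proof -
    have "card V - card {a, b, x} \<le> card ?W" by (intro diff_card_le_card_Diff) auto
    moreover have "card {a, b, x} \<le> 3" by (auto simp: card_insert_if)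
    ultimately show ?thesis using q by (auto intro!: power_decreasing)
  qed
  finally show ?thesis .
qed

text \<open>A union bound over the triples \<open>(a, b, x)\<close>, of which there are at most
  \<open>n ^ 3\<close>.\<close>

lemma prob_extension_property:
  assumes p: "0 < p" "p < 1"
  shows "measure_pmf.prob (random_graph n p) {E. extension_property {1..n} E}
    \<ge> 1 - real n ^ 3 * (1 - p\<^sup>2 * (1 - p)) ^ (n - 3)"
proof -
  let ?V = "{1..n}" and ?q = "1 - p\<^sup>2 * (1 - p)"
  let ?K = "complete_edges ?V"
  let ?M = "Pi_pmf ?K False (\<lambda>_. bernoulli_pmf p)"
  define I where "I = {(a, b, x). (a, b, x) \<in> ?V \<times> ?V \<times> ?V \<and> x \<noteq> a \<and> x \<noteq> b}"
  define bad where "bad t = (case t of (a, b, x) \<Rightarrow>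
    {f. \<forall>z\<in>?V - {a, b, x}. \<not> (f {z, a} \<and> f {z, b} \<and> \<not> f {z, x})})" for t :: "nat \<times> nat \<times> nat"
  let ?good = "{f. extension_property ?V {e \<in> ?K. f e}}"
  have I: "I \<subseteq> ?V \<times> ?V \<times> ?V" by (auto simp: I_def)
  then have fin: "finite I" by (rule finite_subset) simp
  have "card I \<le> card (?V \<times> ?V \<times> ?V)" using I by (intro card_mono) auto
  then have "real (card I) \<le> real (n ^ 3)" by (simp add: card_cartesian_product power3_eq_cube mult.assoc del: of_nat_mult of_nat_power)
  then have card_I: "real (card I) \<le> real n ^ 3" by simp
  have q: "0 \<le> ?q" "?q \<le> 1" using p by (auto simp: mult_le_one power_le_one)
  have "- ?good \<subseteq> (\<Union>t\<in>I. bad t)"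
  proof
    fix f assume "f \<in> - ?good"
    then obtain a b x where abx: "a \<in> ?V" "b \<in> ?V" "x \<in> ?V" "x \<noteq> a" "x \<noteq> b"
      and none: "\<And>z. z \<in> ?V - {a, b, x} \<Longrightarrow>
        \<not> ({z, a} \<in> {e \<in> ?K. f e} \<and> {z, b} \<in> {e \<in> ?K. f e} \<and> {z, x} \<notin> {e \<in> ?K. f e})"
      unfolding extension_property_def by blast
    have "{z, c} \<in> ?K" if "z \<in> ?V - {a, b, x}" "c \<in> {a, b, x}" for z c
      using that abx by (intro pair_complete_edges) auto
    then have "f \<in> bad (a, b, x)" using none by (auto simp: bad_def)
    moreover have "(a, b, x) \<in> I" using abx by (simp add: I_def)
    ultimately show "f \<in> (\<Union>t\<in>I. bad t)" by blast
  qed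
  then have "measure_pmf.prob ?M (- ?good) \<le> measure_pmf.prob ?M (\<Union>t\<in>I. bad t)"
    by (intro measure_pmf.finite_measure_mono) auto
  also have "\<dots> \<le> (\<Sum>t\<in>I. measure_pmf.prob ?M (bad t))"
    using fin by (intro measure_pmf.finite_measure_subadditive_finite) auto
  also have "\<dots> \<le> (\<Sum>t\<in>I. ?q ^ (n - 3))"
  proof (rule sum_mono)
    fix t assume "t \<in> I"
    then obtain a b x where "t = (a, b, x)" "a \<in> ?V" "b \<in> ?V" "x \<in> ?V" "x \<noteq> a" "x \<noteq> b"
      by (auto simp: I_def)
    then show "measure_pmf.prob ?M (bad t) \<le> ?q ^ (n - 3)"
      using prob_no_extension[of ?V a b x p] p by (simp add: bad_def)
  qed
  also have "\<dots> \<le> real n ^ 3 * ?q ^ (n - 3)"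
    using card_I q by (simp add: mult_right_mono)
  finally have "measure_pmf.prob ?M (- ?good) \<le> real n ^ 3 * ?q ^ (n - 3)" .
  moreover have "measure_pmf.prob ?M (- ?good) = 1 - measure_pmf.prob ?M ?good"
    using measure_pmf.prob_compl[of ?good ?M] by (simp add: Compl_eq_Diff_UNIV)
  moreover have "measure_pmf.prob (random_graph n p) {E. extension_property ?V E} = measure_pmf.prob ?M ?good"
    by (simp add: random_graph_def vimage_def)
  ultimately show ?thesis by linarith
qed

lemma cube_times_power_tendsto_zero:
  fixes r :: real
  assumes "0 < r" "r < 1"
  shows "(\<lambda>n. real n ^ 3 * r ^ (n - 3)) \<longlonglongrightarrow> 0"
proof (rule Lim_transform_eventually)
  show "(\<lambda>n. real n ^ 3 * r ^ n / r ^ 3) \<longlonglongrightarrow> 0"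
    using assms by real_asymp
  show "\<forall>\<^sub>F n in sequentially. real n ^ 3 * r ^ n / r ^ 3 = real n ^ 3 * r ^ (n - 3)"
    using eventually_ge_at_top[of 3] by eventually_elim (use assms in \<open>simp add: power_diff\<close>)
qed

lemma finite_Out_raag:
  fixes n :: nat
  assumes "extension_property {1..n} E" "2 \<le> n"
  shows "finite (carrier (Out (raag {1..n} E)))"
proof -
  interpret extension_graph "{1..n}" E "raag {1..n} E"
  proof
    show "\<exists>v\<in>{1..n}. v \<noteq> x" if "x \<in> {1..n}" for x
      using assms(2) by (intro bexI[of _ "if x = 1 then 2 else 1"]) auto
  qed (use assms(1) in \<open>auto simp: extension_property_def\<close>)
  show ?thesis by (rule finite_Out)
qed

theorem theorem7:
  fixes p :: real
  assumes "1 - 1 / sqrt 2 < p" and "p < 1"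
  shows "(\<lambda>n. measure_pmf.prob (random_graph n p)
            {E. finite (carrier (Out (raag {1..n} E)))}) \<longlonglongrightarrow> 1"
proof (rule tendsto_sandwich[where h = "\<lambda>_. 1"])
  let ?q = "1 - p\<^sup>2 * (1 - p)"
  have "1 / sqrt 2 < 1" by simp
  then have p: "0 < p" using assms(1) by linarith
  have "p\<^sup>2 < 1" using p assms(2) by (simp add: power_less_one_iff)
  moreover have "p\<^sup>2 * (1 - p) \<le> p\<^sup>2 * 1" using p by (intro mult_left_mono) auto
  ultimately have "0 < ?q" by linarith
  moreover have "?q < 1" using p assms(2) by simp
  ultimately have "(\<lambda>n. real n ^ 3 * ?q ^ (n - 3)) \<longlonglongrightarrow> 0"
    by (rule cube_times_power_tendsto_zero)
  from tendsto_diff[OF tendsto_const[of 1] this]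
  show "(\<lambda>n. 1 - real n ^ 3 * ?q ^ (n - 3)) \<longlonglongrightarrow> 1" by simp
  show "\<forall>\<^sub>F n in sequentially. 1 - real n ^ 3 * ?q ^ (n - 3) \<le>
    measure_pmf.prob (random_graph n p) {E. finite (carrier (Out (raag {1..n} E)))}"
    using eventually_ge_at_top[of 2]
  proof eventually_elim
    case (elim n)
    have "1 - real n ^ 3 * ?q ^ (n - 3) \<le>
        measure_pmf.prob (random_graph n p) {E. extension_property {1..n} E}"
      using p assms(2) by (rule prob_extension_property)
    also have "\<dots> \<le> measure_pmf.prob (random_graph n p) {E. finite (carrier (Out (raag {1..n} E)))}"
      using finite_Out_raag elim by (intro measure_pmf.finite_measure_mono) auto
    finally show ?case .
  qed
qed (auto intro!: always_eventually)

end
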